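(* There is a randomized algorithm which, given only the vertex set $V$ ($|V|=n$) of an unknown almost-tree $G=(V,E)$ of height $h$ with maximum degree bounded by a fixed constant $d$ and with no transitive edges, and access to path queries on $G$, determines the root $r$ and the edge set $E$ of $G$ using $O(n\log n+nh)$ path queries in $O(\log n)$ parallel rounds, with high probability.
   Context: An arborescence with root $r$ is a rooted directed acyclic graph with exactly one directed path from $r$ to each vertex. An almost-tree is a rooted DAG $G$ that is the union of an arborescence $T$ on $V$ and one additional cross edge $(s,t)$, i.e. an edge such that neither of $s,t$ is an ancestor of the other in $T$. The height of an almost-tree is the length of its longest directed path. An edge $(u,v)$ is transitive if there is also a directed path from $u$ to $v$ of length greater than $1$. The degree of a vertex is its in-degree plus its out-degree. A path query $\mathsf{path}(u,v)$ returns $1$ if there is a directed path from $u$ to $v$ in $G$ and $0$ otherwise. Queries are issued in rounds; queries within a round may depend only on answers from earlier rounds. "With high probability" means with probability at least $1-1/n^{c}$ for some constant $c\ge1$. *)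

theory Defs
  imports "Graph_Theory.Graph_Theory" "HOL-Probability.Probability_Mass_Function"
begin

section \<open>Almost-trees\<close>

text \<open>
  Digraphs are the digraphs without parallel arcs of Graph_Theory. Directed paths are its
  vertex-distinct walks \<open>apath\<close>, given by their list of arcs; the empty list is the path of
  length 0 from a vertex to itself.
\<close>

abbreviation dpath :: "'v pair_pre_digraph \<Rightarrow> 'v \<Rightarrow> ('v \<times> 'v) awalk \<Rightarrow> 'v \<Rightarrow> bool" where
  "dpath G \<equiv> pre_digraph.apath (with_proj G)"

definition path_query :: "'v pair_pre_digraph \<Rightarrow> 'v \<times> 'v \<Rightarrow> bool" where
  "path_query G = (\<lambda>(u, v). \<exists>p. dpath G u p v)"

definition rooted_dag :: "'v pair_pre_digraph \<Rightarrow> 'v \<Rightarrow> bool" where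
  "rooted_dag G r \<longleftrightarrow> pair_fin_digraph G \<and> acyclic (parcs G) \<and>
     r \<in> pverts G \<and> (\<forall>v\<in>pverts G. \<exists>p. dpath G r p v)"

definition arborescence :: "'v pair_pre_digraph \<Rightarrow> 'v \<Rightarrow> bool" where
  "arborescence T r \<longleftrightarrow> rooted_dag T r \<and> (\<forall>v\<in>pverts T. \<exists>!p. dpath T r p v)"

text \<open>Every vertex counts as an ancestor of itself.\<close>

definition ancestor :: "'v pair_pre_digraph \<Rightarrow> 'v \<Rightarrow> 'v \<Rightarrow> bool" where
  "ancestor T u v \<longleftrightarrow> (\<exists>p. dpath T u p v)"

definition almost_tree :: "'v pair_pre_digraph \<Rightarrow> 'v \<Rightarrow> bool" where
  "almost_tree G r \<longleftrightarrow> rooted_dag G r \<and>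
     (\<exists>T s t. arborescence T r \<and> pverts T = pverts G \<and>
        s \<in> pverts G \<and> t \<in> pverts G \<and> \<not> ancestor T s t \<and> \<not> ancestor T t s \<and>
        parcs G = parcs T \<union> {(s, t)})"

definition dag_height :: "'v pair_pre_digraph \<Rightarrow> nat" where
  "dag_height G = Max {length p | u p v. dpath G u p v}"

definition transitive_edge :: "'v pair_pre_digraph \<Rightarrow> 'v \<times> 'v \<Rightarrow> bool" where
  "transitive_edge G = (\<lambda>(u, v). (u, v) \<in> parcs G \<and> (\<exists>p. dpath G u p v \<and> length p > 1))"

definition vertex_degree :: "'v pair_pre_digraph \<Rightarrow> 'v \<Rightarrow> nat" where
  "vertex_degree G v = in_degree (with_proj G) v + out_degree (with_proj G) v"

section \<open>Randomized query algorithms\<close>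

text \<open>
  A randomized algorithm with queries of type \<open>'q\<close> and output of type \<open>'r\<close> is a well-founded
  tree: \<open>Random P\<close> makes an internal random choice, and \<open>Round qs k\<close> issues the queries \<open>qs\<close>
  simultaneously and continues with \<open>k\<close> applied to the list of their answers, in order.
\<close>

datatype ('q, 'r) query_alg =
    Output 'r
  | Random "('q, 'r) query_alg pmf"
  | Round "'q list" "bool list \<Rightarrow> ('q, 'r) query_alg"

text \<open>
  Joint distribution of the output, the total number of queries (with repetitions) and the
  number of rounds when the queries are answered by \<open>orc\<close>. The \<open>Random\<close> case is
  \<open>bind_pmf P (run_alg orc)\<close>, in the form required by \<open>primrec\<close>.
\<close>

primrec run_alg :: "('q \<Rightarrow> bool) \<Rightarrow> ('q, 'r) query_alg \<Rightarrow> ('r \<times> nat \<times> nat) pmf" where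
  "run_alg orc (Output x) = return_pmf (x, 0, 0)"
| "run_alg orc (Random P) = join_pmf (map_pmf (run_alg orc) P)"
| "run_alg orc (Round qs k) =
     map_pmf (\<lambda>(x, q, \<rho>). (x, q + length qs, \<rho> + 1)) (run_alg orc (k (map orc qs)))"

end

theory Submission
  imports Defs "HOL-Probability.Product_PMF"
begin

text \<open>
  The algorithm learns the reachability order \<open>R\<close>, whose cover relation is \<open>G\<close> because there are no
  transitive edges. It maintains a partition of \<open>V\<close> into convex parts with a least element. In one
  level every part \<open>P\<close> draws \<open>v\<close>, \<open>w\<close>, \<open>w'\<close> uniformly, learns their ancestors within \<open>P\<close>, picks any
  common ancestor \<open>x\<close> of \<open>v\<close> and \<open>w\<close> that is not an ancestor of \<open>w'\<close>, and splits \<open>P\<close> into the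
  descendants of \<open>x\<close> and the rest. The pairs \<open>(a, u)\<close> with \<open>a \<le> x \<le> u\<close> become known. Bounded degree
  gives a vertex \<open>c\<close> whose descendants are a constant fraction, but at most half, of \<open>P\<close>; symmetry
  among the three vertices drawn below \<open>c\<close> and among the two drawn outside shows that in expectation
  a constant fraction of the pairs of \<open>P\<close> is separated. Hence the expected number of unseparated
  pairs decreases geometrically, and by Markov's inequality all parts are singletons after
  \<open>O(log n)\<close> levels of \<open>O(n)\<close> queries, up to probability \<open>1 / n\<close>.

  In a tree this finds all of \<open>R\<close>. With the cross edge \<open>(s, t)\<close> and the tree parent \<open>p\<close> of \<open>t\<close>, pairs
  are lost only when \<open>x\<close> lies above one of \<open>s\<close>, \<open>p\<close> but not above the other; this happens once, and
  loses the connections from the branch above the other vertex to some set \<open>D\<close> of descendants of \<open>t\<close>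
  with \<open>t \<in> D\<close>. Asking, for every known pair \<open>(a, u)\<close> and every child \<open>c\<close> of \<open>a\<close>, whether \<open>c\<close> reaches
  \<open>u\<close> takes \<open>O(n h)\<close> queries, reveals \<open>D\<close>, hence \<open>t\<close>, and the ancestors of \<open>t\<close> complete \<open>R\<close>.
\<close>

section \<open>The reachability order of an almost-tree\<close>

definition anc :: "('v \<times> 'v) set \<Rightarrow> 'v \<Rightarrow> 'v set" where
  "anc R u = {a. (a, u) \<in> R}"

definition covers :: "('v \<times> 'v) set \<Rightarrow> 'v \<Rightarrow> 'v set" where
  "covers R a = {c. (a, c) \<in> R \<and> a \<noteq> c \<and> \<not> (\<exists>b. (a, b) \<in> R \<and> (b, c) \<in> R \<and> b \<noteq> a \<and> b \<noteq> c)}"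

lemma mem_anc [simp]: "a \<in> anc R u \<longleftrightarrow> (a, u) \<in> R"
  by (simp add: anc_def)

text \<open>The order-theoretic content of an almost-tree. \<open>s\<close> and \<open>p\<close> are
  the two parents of \<open>t\<close>, and the assumptions are symmetric in them, so it no longer
  matters which one is the tail of the cross edge. Among the vertices not below \<open>t\<close>,
  and likewise among those below \<open>t\<close>, ancestors form chains as in a tree; the two
  regions are joined only through \<open>t\<close>.\<close>

locale almost_tree_order =
  fixes V :: "'v set" and R :: "('v \<times> 'v) set" and r t s p :: 'v and d H :: nat
  assumes finite_V: "finite V"
    and R_subset: "R \<subseteq> V \<times> V"
    and R_refl: "u \<in> V \<Longrightarrow> (u, u) \<in> R"
    and R_trans: "(a, b) \<in> R \<Longrightarrow> (b, c) \<in> R \<Longrightarrow> (a, c) \<in> R"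
    and R_antisym: "(a, b) \<in> R \<Longrightarrow> (b, a) \<in> R \<Longrightarrow> a = b"
    and root: "r \<in> V" "u \<in> V \<Longrightarrow> (r, u) \<in> R"
    and t_above: "(s, t) \<in> R" "(p, t) \<in> R" "(t, s) \<notin> R" "(t, p) \<notin> R"
    and sp_incomp: "(s, p) \<notin> R" "(p, s) \<notin> R"
    and above_t: "(a, t) \<in> R \<Longrightarrow> a = t \<or> (a, s) \<in> R \<or> (a, p) \<in> R"
    and chain_outside: "(a, u) \<in> R \<Longrightarrow> (b, u) \<in> R \<Longrightarrow> (t, u) \<notin> R \<Longrightarrow> (a, b) \<in> R \<or> (b, a) \<in> R"
    and chain_inside: "(a, u) \<in> R \<Longrightarrow> (b, u) \<in> R \<Longrightarrow> (t, a) \<in> R \<Longrightarrow> (t, b) \<in> R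
      \<Longrightarrow> (a, b) \<in> R \<or> (b, a) \<in> R"
    and enter_via_t: "(a, u) \<in> R \<Longrightarrow> (t, u) \<in> R \<Longrightarrow> (t, a) \<notin> R \<Longrightarrow> (a, t) \<in> R"
    and card_anc: "u \<in> V \<Longrightarrow> card (anc R u) \<le> H"
    and card_covers: "a \<in> V \<Longrightarrow> card (covers R a) \<le> d"

section \<open>Directed paths and the reflexive transitive closure of the arcs\<close>

lemma dpath_Nil_iff: "dpath G u [] v \<longleftrightarrow> u = v \<and> u \<in> pverts G"
  by (auto simp: pre_digraph.apath_def pre_digraph.awalk_def pre_digraph.cas.simps
      pre_digraph.awalk_verts.simps)

lemma dpath_verts_reachable:
  assumes "dpath G u q v" "y \<in> set (pawalk_verts u q)"
  shows "(u, y) \<in> (parcs G)\<^sup>*"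
proof -
  have "set q \<subseteq> parcs G \<Longrightarrow> pcas u q v \<Longrightarrow> y \<in> set (pawalk_verts u q) \<Longrightarrow> (u, y) \<in> (parcs G)\<^sup>*"
    by (induction q arbitrary: u) (auto intro: converse_rtrancl_into_rtrancl)
  then show ?thesis
    using assms by (simp add: pre_digraph.apath_def pre_digraph.awalk_def cas_with_proj_eq)
qed

text \<open>Acyclicity supplies the distinctness condition of \<open>apath\<close>: a return to the
  tail of \<open>e\<close> would close a cycle.\<close>

lemma dpath_Cons_iff:
  assumes "pair_wf_digraph G" "acyclic (parcs G)"
  shows "dpath G u (e # q) v \<longleftrightarrow> e \<in> parcs G \<and> fst e = u \<and> dpath G (snd e) q v"
proof -
  interpret pair_wf_digraph G by fact
  have "fst e \<notin> set (pawalk_verts (snd e) q)" if "dpath G (snd e) q v" "e \<in> parcs G"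
  proof
    assume "fst e \<in> set (pawalk_verts (snd e) q)"
    from dpath_verts_reachable[OF that(1) this] have "(fst e, fst e) \<in> (parcs G)\<^sup>+"
      using that(2) rtrancl_into_trancl2[of "fst e" "snd e" "parcs G" "fst e"] by simp
    then show False using assms(2) by (simp add: acyclic_def)
  qed
  then show ?thesis by (auto simp: apath_Cons_iff)
qed

lemma dpath_reachable:
  assumes "dpath G u q v"
  shows "u \<in> pverts G \<and> (u, v) \<in> (parcs G)\<^sup>*"
proof -
  have "pcas u q v \<Longrightarrow> v \<in> set (pawalk_verts u q)"
    by (induction q arbitrary: u) auto
  then show ?thesis
    using assms dpath_verts_reachable[OF assms, of v]
    by (simp add: pre_digraph.apath_def pre_digraph.awalk_def cas_with_proj_eq)
qed

lemma dpath_append: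
  assumes "pair_wf_digraph G" "acyclic (parcs G)" "dpath G u q v" "dpath G v q' w"
  shows "dpath G u (q @ q') w"
  using assms(3,4)
  by (induction q arbitrary: u) (auto simp: dpath_Nil_iff dpath_Cons_iff[OF assms(1,2)])

lemma dpath_exists_iff:
  assumes "pair_wf_digraph G" "acyclic (parcs G)"
  shows "(\<exists>q. dpath G u q v) \<longleftrightarrow> u \<in> pverts G \<and> (u, v) \<in> (parcs G)\<^sup>*"
proof -
  have "\<exists>q. dpath G u q v" if "(u, v) \<in> (parcs G)\<^sup>*" "u \<in> pverts G"
    using that
  proof (induction rule: converse_rtrancl_induct)
    case base
    then have "dpath G v [] v" by (simp add: dpath_Nil_iff)
    then show ?case ..
  next
    case (step x y)
    then obtain q where "dpath G y q v"
      using pair_wf_digraph.in_arcsD2[OF assms(1)] by blast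
    then have "dpath G x ((x, y) # q) v" using step(1) dpath_Cons_iff[OF assms] by simp
    then show ?case ..
  qed
  then show ?thesis using dpath_reachable[of G u _ v] by auto
qed

section \<open>From an almost-tree to the abstract order\<close>

lemma arborescence_single_valued:
  assumes "arborescence T r"
  shows "single_valued ((parcs T)\<inverse>)"
proof (rule single_valuedI)
  fix x y z assume "(x, y) \<in> (parcs T)\<inverse>" "(x, z) \<in> (parcs T)\<inverse>"
  then have arcs: "(y, x) \<in> parcs T" "(z, x) \<in> parcs T" by auto
  from assms have T: "pair_wf_digraph T" "acyclic (parcs T)"
    and root: "\<forall>v\<in>pverts T. \<exists>!q. dpath T r q v"
    by (auto simp: arborescence_def rooted_dag_def pair_fin_digraph_def)
  interpret pair_wf_digraph T by fact
  have V: "x \<in> pverts T" "y \<in> pverts T" "z \<in> pverts T" using arcs wellformed' by auto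
  then obtain q q' where q: "dpath T r q y" "dpath T r q' z" using root by blast
  have "dpath T y [(y, x)] x" "dpath T z [(z, x)] x"
    using arcs V by (auto simp: dpath_Cons_iff[OF T] dpath_Nil_iff)
  then have "dpath T r (q @ [(y, x)]) x" "dpath T r (q' @ [(z, x)]) x"
    using q dpath_append[OF T] by blast+
  \<comment> \<open>Uniqueness of the root path to \<open>x\<close> forces the two last arcs, hence
    the two parents, to agree.\<close>
  then have "q @ [(y, x)] = q' @ [(z, x)]" using root V by blast
  then show "y = z" by simp
qed

text \<open>The depth of a vertex is the length of a longest path from the root; it strictly increases
  along paths and is bounded by the height.\<close>

lemma card_chain_le_height:
  assumes dag: "rooted_dag G r" and X: "X \<subseteq> pverts G"
    and chain: "\<And>a b. a \<in> X \<Longrightarrow> b \<in> X \<Longrightarrow> (a, b) \<in> (parcs G)\<^sup>* \<or> (b, a) \<in> (parcs G)\<^sup>*"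
  shows "card X \<le> dag_height G + 1"
proof -
  from dag have fin: "pair_fin_digraph G" and G: "pair_wf_digraph G" "acyclic (parcs G)"
    and root: "\<forall>v\<in>pverts G. \<exists>q. dpath G r q v"
    by (auto simp: rooted_dag_def pair_fin_digraph_def)
  interpret pair_fin_digraph G by fact
  have "{length q | u q v. dpath G u q v} = (\<lambda>(u, q, v). length q) ` {(u, q, v). dpath G u q v}"
    by force
  then have finL: "finite {length q | u q v. dpath G u q v}"
    using apaths_finite_triple by simp
  define depth where "depth v = Max {length q | q. dpath G r q v}" for v
  have finD: "finite {length q | q. dpath G r q v}" for v
    by (rule finite_subset[OF _ finL]) auto
  have neD: "{length q | q. dpath G r q v} \<noteq> {}" if "v \<in> pverts G" for v
    using root that by blast
  have less: "depth a < depth b"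
    if ab: "(a, b) \<in> (parcs G)\<^sup>*" "a \<noteq> b" and V: "a \<in> pverts G" "b \<in> pverts G" for a b
  proof -
    obtain q where q: "dpath G r q a" "depth a = length q"
      using Max_in[OF finD neD[OF V(1)]] by (auto simp: depth_def)
    obtain q' where q': "dpath G a q' b"
      using dpath_exists_iff[OF G] ab V by blast
    then have "q' \<noteq> []" using ab by (auto simp: dpath_Nil_iff)
    moreover have "dpath G r (q @ q') b" using dpath_append[OF G] q q' by blast
    then have "length (q @ q') \<le> depth b"
      unfolding depth_def by (intro Max_ge finD) blast
    ultimately show ?thesis using q by (cases q') auto
  qed
  have "inj_on depth X"
  proof (rule inj_onI, rule ccontr)
    fix a b assume "a \<in> X" "b \<in> X" "depth a = depth b" "a \<noteq> b"
    then show False using less[of a b] less[of b a] chain[of a b] X by auto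
  qed
  moreover have "depth ` X \<subseteq> {..dag_height G}"
  proof
    fix k assume "k \<in> depth ` X"
    then obtain v where v: "v \<in> pverts G" "k = depth v" using X by auto
    obtain q where "dpath G r q v" "k = length q"
      using Max_in[OF finD neD[OF v(1)]] v by (auto simp: depth_def)
    then have "k \<in> {length q | u q v. dpath G u q v}" by blast
    then show "k \<in> {..dag_height G}"
      using Max_ge[OF finL] by (simp add: dag_height_def)
  qed
  ultimately show ?thesis using card_inj_on_le[of depth X "{..dag_height G}"] by simp
qed

lemma path_query_iff:
  assumes "rooted_dag G r"
  shows "path_query G (u, v) \<longleftrightarrow> u \<in> pverts G \<and> (u, v) \<in> (parcs G)\<^sup>*"
  using assms dpath_exists_iff[of G]
  by (auto simp: path_query_def rooted_dag_def pair_fin_digraph_def)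

text \<open>A vertex strictly between the ends of an edge would make it transitive, by concatenating
  the two partial paths; conversely, the first arc of a path to a cover must already end there.
  Hence knowing \<open>R\<close> suffices to output \<open>G\<close>.\<close>

lemma parcs_eq_covers:
  assumes dag: "rooted_dag G r" and notrans: "\<And>e. \<not> transitive_edge G e"
    and R: "R = {(u, v). path_query G (u, v)}"
  shows "parcs G = {(u, v). v \<in> covers R u}"
proof -
  from dag have G: "pair_wf_digraph G" "acyclic (parcs G)"
    by (auto simp: rooted_dag_def pair_fin_digraph_def)
  interpret pair_wf_digraph G by fact
  have R_iff: "(u, v) \<in> R \<longleftrightarrow> u \<in> pverts G \<and> (u, v) \<in> (parcs G)\<^sup>*" for u v
    using path_query_iff[OF dag] R by simp
  have "(u, v) \<in> parcs G" if c: "v \<in> covers R u" for u v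
  proof -
    from c have uv: "u \<in> pverts G" "(u, v) \<in> (parcs G)\<^sup>*" "u \<noteq> v"
      by (auto simp: covers_def R_iff)
    then obtain b where b: "(u, b) \<in> parcs G" "(b, v) \<in> (parcs G)\<^sup>*"
      by (meson converse_rtranclE)
    moreover have "u \<noteq> b" using b(1) G(2) by (auto simp: acyclic_def)
    ultimately have "b = v" using c uv wellformed' unfolding covers_def R_iff by blast
    then show ?thesis using b by simp
  qed
  moreover have "v \<in> covers R u" if uv: "(u, v) \<in> parcs G" for u v
  proof -
    have V: "u \<in> pverts G" "v \<in> pverts G" using uv wellformed' by auto
    have False if b: "(u, b) \<in> R" "(b, v) \<in> R" "b \<noteq> u" "b \<noteq> v" for b
    proof -
      obtain q q' where q: "dpath G u q b" "dpath G b q' v"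
        using b dpath_exists_iff[OF G] unfolding R_iff by blast
      have "q \<noteq> []" "q' \<noteq> []" using q b by (auto simp: dpath_Nil_iff)
      then have "length (q @ q') > 1" by (cases q; cases q') auto
      moreover have "dpath G u (q @ q') v" using q dpath_append[OF G] by blast
      ultimately have "transitive_edge G (u, v)" using uv by (auto simp: transitive_edge_def)
      then show False using notrans by blast
    qed
    moreover have "u \<noteq> v" using uv G(2) by (auto simp: acyclic_def)
    ultimately show ?thesis using uv V by (auto simp: covers_def R_iff)
  qed
  ultimately show ?thesis by auto
qed

text \<open>The factor 3 arises because the ancestors of a vertex below \<open>t\<close> lie in
  three chains, above \<open>s\<close>, above \<open>p\<close> and below \<open>t\<close>, each of
  at most \<open>dag_height G + 1\<close> vertices.\<close>

lemma almost_tree_imp_order: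
  assumes G: "almost_tree G r" and notrans: "\<And>e. \<not> transitive_edge G e"
    and deg: "\<And>v. v \<in> pverts G \<Longrightarrow> vertex_degree G v \<le> d"
    and R: "R = {(u, v). path_query G (u, v)}"
  obtains t s p where "almost_tree_order (pverts G) R r t s p d (3 * (dag_height G + 1))"
proof -
  let ?V = "pverts G"
  from G have dag: "rooted_dag G r" by (simp add: almost_tree_def)
  then have wf: "pair_wf_digraph G" "acyclic (parcs G)" and fin: "pair_fin_digraph G"
    and rV: "r \<in> ?V" and rG: "\<forall>v\<in>?V. \<exists>q. dpath G r q v"
    by (auto simp: rooted_dag_def pair_fin_digraph_def)
  interpret pair_fin_digraph G by fact
  from G obtain T s t where T: "arborescence T r" and VT: "pverts T = ?V"
    and stV: "s \<in> ?V" "t \<in> ?V" and st: "\<not> ancestor T s t" "\<not> ancestor T t s"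
    and E: "parcs G = insert (s, t) (parcs T)"
    by (auto simp: almost_tree_def)
  from T have wfT: "pair_wf_digraph T" "acyclic (parcs T)"
    and rT: "\<forall>v\<in>?V. \<exists>q. dpath T r q v"
    by (auto simp: arborescence_def rooted_dag_def pair_fin_digraph_def VT)
  let ?S = "(parcs T)\<^sup>*"
  have nst: "(s, t) \<notin> ?S" "(t, s) \<notin> ?S"
    using st stV dpath_exists_iff[OF wfT] VT by (auto simp: ancestor_def)
  have R_iff: "(u, v) \<in> R \<longleftrightarrow> u \<in> ?V \<and> (u, v) \<in> (parcs G)\<^sup>*" for u v
    using path_query_iff[OF dag] R by simp
  \<comment> \<open>Reachability in \<open>G\<close> is tree reachability with at most one passage
    through the cross edge.\<close>
  have reach: "(u, v) \<in> (parcs G)\<^sup>* \<longleftrightarrow> (u, v) \<in> ?S \<or> (u, s) \<in> ?S \<and> (t, v) \<in> ?S" for u v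
    by (auto simp: E rtrancl_insert)
  have S_chain: "(a, b) \<in> ?S \<or> (b, a) \<in> ?S" if "(a, u) \<in> ?S" "(b, u) \<in> ?S" for a b u
    using single_valued_confluent[OF arborescence_single_valued[OF T], of u a b] that
    by (auto simp: rtrancl_converse)
  have inV: "v \<in> ?V" if "(u, v) \<in> (parcs G)\<^sup>*" "u \<in> ?V" for u v
    using that by (induction rule: rtrancl_induct) (auto dest: wellformed')
  have t_iff: "(t, u) \<in> R \<longleftrightarrow> (t, u) \<in> ?S" for u
    using stV nst by (auto simp: R_iff reach)
  have "(r, t) \<in> ?S" "(r, s) \<in> ?S"
    using rT stV dpath_exists_iff[OF wfT] by auto
  \<comment> \<open>The root reaches \<open>s\<close> in the tree and \<open>t\<close> does not, so
    \<open>t\<close> is not the root and has a tree parent \<open>p\<close>.\<close>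
  moreover have "r \<noteq> t" using nst \<open>(r, s) \<in> ?S\<close> by auto
  ultimately obtain p where p: "(r, p) \<in> ?S" "(p, t) \<in> parcs T"
    by (meson rtranclE)
  have pV: "p \<in> ?V" using p(2) wellformed' E by blast
  have ac: "(b, a) \<notin> (parcs G)\<^sup>*" if "(a, b) \<in> parcs G" for a b
    using that wf(2) rtrancl_into_trancl2[of a b "parcs G" a] by (auto simp: acyclic_def)
  have trR: "(a, c) \<in> R" if "(a, b) \<in> R" "(b, c) \<in> R" for a b c
    using that by (auto simp: R_iff)
  have asR: "a = b" if "(a, b) \<in> R" "(b, a) \<in> R" for a b
    using that acyclic_impl_antisym_rtrancl[OF wf(2)] by (auto simp: R_iff antisym_def)
  \<comment> \<open>A path from \<open>p\<close> to \<open>s\<close>, continued by the cross edge,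
    would make the tree edge \<open>(p, t)\<close> transitive.\<close>
  have ps: "(p, s) \<notin> R"
  proof
    assume "(p, s) \<in> R"
    then obtain q where q: "dpath G p q s" using dpath_exists_iff[OF wf] by (auto simp: R_iff)
    have "p \<noteq> s" using p(2) nst by auto
    then have "q \<noteq> []" using q by (auto simp: dpath_Nil_iff)
    moreover have "dpath G s [(s, t)] t"
      using E stV by (auto simp: dpath_Cons_iff[OF wf] dpath_Nil_iff)
    then have "dpath G p (q @ [(s, t)]) t" using q dpath_append[OF wf] by blast
    ultimately have "transitive_edge G (p, t)"
      using p(2) E by (auto simp: transitive_edge_def intro!: exI[of _ "q @ [(s, t)]"])
    then show False using notrans by blast
  qed
  have tp: "(t, p) \<notin> R" using ac[of p t] p(2) E by (auto simp: R_iff)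
  have outside: "(a, u) \<in> ?S" if "(a, u) \<in> R" "(t, u) \<notin> R" for a u
    using that by (auto simp: R_iff reach stV)
  have chain_out: "(a, b) \<in> R \<or> (b, a) \<in> R" if "(a, u) \<in> R" "(b, u) \<in> R" "(t, u) \<notin> R" for a b u
    using S_chain[OF outside[OF that(1,3)] outside[OF that(2,3)]] that by (auto simp: R_iff reach)
  have inside: "(a, u) \<in> ?S" if "(a, u) \<in> R" "(t, a) \<in> R" for a u
    using that nst by (auto simp: R_iff reach stV dest: rtrancl_trans)
  have chain_in: "(a, b) \<in> R \<or> (b, a) \<in> R"
    if "(a, u) \<in> R" "(b, u) \<in> R" "(t, a) \<in> R" "(t, b) \<in> R" for a b u
    using S_chain[OF inside[OF that(1,3)] inside[OF that(2,4)]] that by (auto simp: R_iff reach)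
  have enter: "(a, t) \<in> R" if "(a, u) \<in> R" "(t, u) \<in> R" "(t, a) \<notin> R" for a u
    using that S_chain[of a u t] by (auto simp: R_iff reach stV)
  have above: "a = t \<or> (a, s) \<in> R \<or> (a, p) \<in> R" if "(a, t) \<in> R" for a
  proof -
    have "(a, p) \<in> ?S" if at: "(a, t) \<in> ?S" "a \<noteq> t"
    proof -
      obtain b where "(a, b) \<in> ?S" "(b, t) \<in> parcs T" using at by (meson rtranclE)
      then show ?thesis
        using p(2) single_valuedD[OF arborescence_single_valued[OF T], of t b p] by auto
    qed
    then show ?thesis using that by (auto simp: R_iff reach)
  qed
  have tsR: "(t, s) \<notin> R" using nst t_iff by simp
  have card_le: "card (anc R u) \<le> 3 * (dag_height G + 1)" if "u \<in> ?V" for u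
  proof -
    have chain: "card X \<le> dag_height G + 1"
      if "X \<subseteq> anc R u" "\<And>a b. a \<in> X \<Longrightarrow> b \<in> X \<Longrightarrow> (a, b) \<in> R \<or> (b, a) \<in> R" for X u
      using that card_chain_le_height[OF dag, of X] by (auto simp: R_iff subset_iff)
    show ?thesis
    proof (cases "(t, u) \<in> R")
      case False
      then have "card (anc R u) \<le> dag_height G + 1"
        by (intro chain[of _ u]) (use chain_out[of _ u] in auto)
      then show ?thesis by simp
    next
      case True
      have "anc R u \<subseteq> anc R s \<union> anc R p \<union> {a \<in> anc R u. (t, a) \<in> R}"
      proof
        fix a assume "a \<in> anc R u"
        then show "a \<in> anc R s \<union> anc R p \<union> {a \<in> anc R u. (t, a) \<in> R}"
          using enter[of a u] above[of a] True by (cases "(t, a) \<in> R") auto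
      qed
      then have "card (anc R u) \<le> card (anc R s \<union> anc R p \<union> {a \<in> anc R u. (t, a) \<in> R})"
        by (rule card_mono[rotated])
          (rule finite_subset[OF _ pair_finite_verts], auto simp: R_iff)
      also have "\<dots> \<le> card (anc R s) + card (anc R p) + card {a \<in> anc R u. (t, a) \<in> R}"
        by (meson card_Un_le add_le_mono1 le_trans)
      also have "\<dots> \<le> (dag_height G + 1) + (dag_height G + 1) + (dag_height G + 1)"
      proof (intro add_mono)
        show "card (anc R s) \<le> dag_height G + 1"
          by (rule chain[of _ s]) (use chain_out[of _ s] tsR in auto)
        show "card (anc R p) \<le> dag_height G + 1"
          by (rule chain[of _ p]) (use chain_out[of _ p] tp in auto)
        show "card {a \<in> anc R u. (t, a) \<in> R} \<le> dag_height G + 1"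
          by (rule chain[of _ u]) (use chain_in[of _ u] in auto)
      qed
      finally show ?thesis by simp
    qed
  qed
  have card_cov: "card (covers R a) \<le> d" if "a \<in> ?V" for a
  proof -
    have "covers R a = snd ` out_arcs (with_proj G) a"
      using parcs_eq_covers[OF dag notrans R] by (force simp: out_arcs_def)
    then have "card (covers R a) \<le> out_degree (with_proj G) a"
      using card_image_le[of "out_arcs (with_proj G) a" snd] pair_finite_arcs
      by (auto simp: out_degree_def)
    also have "\<dots> \<le> d" using deg[OF that] by (simp add: vertex_degree_def)
    finally show ?thesis .
  qed
  \<comment> \<open>Since \<open>p\<close> is not below \<open>t\<close>, a path from
    \<open>s\<close> to \<open>p\<close> would lie in the tree and make \<open>s\<close> a tree
    ancestor of \<open>t\<close>.\<close>
  have sp: "(s, p) \<notin> R"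
  proof
    assume "(s, p) \<in> R"
    then have "(s, p) \<in> ?S" using outside tp by blast
    then show False using p(2) nst by (meson rtrancl.rtrancl_into_rtrancl)
  qed
  have "almost_tree_order ?V R r t s p d (3 * (dag_height G + 1))"
  proof
    show "finite ?V" by (rule pair_finite_verts)
    show "r \<in> ?V" by (rule rV)
    show "R \<subseteq> ?V \<times> ?V" using R_iff inV by auto
    show "(s, t) \<in> R" "(p, t) \<in> R" using R_iff stV pV E p(2) by auto
    show "(r, u) \<in> R" if "u \<in> ?V" for u
      using rG that dpath_exists_iff[OF wf] rV R_iff by blast
    show "(u, u) \<in> R" if "u \<in> ?V" for u using R_iff that by simp
  qed (fact trR asR chain_out chain_in enter above tsR tp ps sp card_le card_cov)+
  then show thesis by (rule that)
qed

section \<open>Balanced random splits\<close>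

lemma card_total_pairs:
  assumes "finite X" "\<And>a b. a \<in> X \<Longrightarrow> b \<in> X \<Longrightarrow> Q a b \<or> Q b a"
  shows "card X ^ 2 \<le> 2 * card {(a, b) \<in> X \<times> X. Q a b}"
proof -
  let ?S = "{(a, b) \<in> X \<times> X. Q a b}"
  have fin: "finite ?S" using assms(1) by (auto intro: finite_subset[of _ "X \<times> X"])
  have "X \<times> X \<subseteq> ?S \<union> prod.swap ` ?S" using assms(2) by force
  then have "card (X \<times> X) \<le> card (?S \<union> prod.swap ` ?S)" using fin by (intro card_mono) auto
  also have "\<dots> \<le> card ?S + card (prod.swap ` ?S)" by (rule card_Un_le)
  also have "\<dots> \<le> 2 * card ?S" using card_image_le[OF fin, of prod.swap] by simp
  finally show ?thesis by (simp add: card_cartesian_product power2_eq_square)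
qed

text \<open>At least half of all pairs are monochromatic, by
  \<open>(x + y) ^ 2 \<le> 2 * (x ^ 2 + y ^ 2)\<close>, and swapping shows that at least half of
  those satisfy \<open>Q\<close>.\<close>

lemma card_two_coloured_pairs:
  fixes col :: "'a \<Rightarrow> bool"
  assumes fin: "finite X"
    and total: "\<And>a b. a \<in> X \<Longrightarrow> b \<in> X \<Longrightarrow> col a = col b \<Longrightarrow> Q a b \<or> Q b a"
  shows "card X ^ 2 \<le> 4 * card {(a, b) \<in> X \<times> X. Q a b}"
proof -
  let ?X = "\<lambda>i::bool. {a \<in> X. col a = i}"
  let ?S = "\<lambda>i. {(a, b) \<in> ?X i \<times> ?X i. Q a b}"
  have fin': "finite (?X i)" "finite (?S i)" for i
    using fin by (auto intro: finite_subset[of _ "X \<times> X"])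
  have "card X = card (?X True \<union> ?X False)" by (rule arg_cong[where f = card]) auto
  also have "\<dots> = card (?X True) + card (?X False)" by (rule card_Un_disjoint) (use fin in auto)
  finally have cardX: "card X = card (?X True) + card (?X False)" .
  have "(x + y) ^ 2 \<le> 2 * (x ^ 2 + y ^ 2)" for x y :: nat
  proof -
    have "0 \<le> (int x - int y) ^ 2" by simp
    then have "int ((x + y) ^ 2) \<le> int (2 * (x ^ 2 + y ^ 2))"
      by (simp add: power2_eq_square algebra_simps)
    then show ?thesis by (simp only: of_nat_le_iff)
  qed
  then have "card X ^ 2 \<le> 2 * (card (?X True) ^ 2 + card (?X False) ^ 2)"
    unfolding cardX .
  also have "\<dots> \<le> 2 * (2 * card (?S True) + 2 * card (?S False))"
    using card_total_pairs[OF fin'(1), of True Q] card_total_pairs[OF fin'(1), of False Q] total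
    by (intro mult_left_mono add_mono) auto
  also have "card (?S True) + card (?S False) = card (?S True \<union> ?S False)"
    by (rule card_Un_disjoint[OF fin'(2) fin'(2), symmetric]) auto
  then have "2 * (2 * card (?S True) + 2 * card (?S False)) = 4 * card (?S True \<union> ?S False)"
    by simp
  also have "\<dots> \<le> 4 * card {(a, b) \<in> X \<times> X. Q a b}"
    using fin by (intro mult_left_mono card_mono) (auto intro: finite_subset[of _ "X \<times> X"])
  finally show ?thesis .
qed

text \<open>The triples satisfying \<open>Q\<close> and their two rotations cover the cube of
  \<open>X\<close>.\<close>

lemma card_triples_cyclic:
  assumes fin: "finite X"
    and total: "\<And>a b c. a \<in> X \<Longrightarrow> b \<in> X \<Longrightarrow> c \<in> X \<Longrightarrow> Q a b c \<or> Q b c a \<or> Q c a b"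
  shows "card X ^ 3 \<le> 3 * card {(a, b, c) \<in> X \<times> X \<times> X. Q a b c}"
proof -
  let ?S = "{(a, b, c) \<in> X \<times> X \<times> X. Q a b c}"
  let ?f = "\<lambda>(a, b, c). (b, c, a)" and ?g = "\<lambda>(a, b, c). (c, a, b)"
  have finS: "finite ?S" using fin by (auto intro: finite_subset[of _ "X \<times> X \<times> X"])
  have "X \<times> X \<times> X \<subseteq> ?S \<union> (?f ` ?S \<union> ?g ` ?S)"
  proof
    fix z assume "z \<in> X \<times> X \<times> X"
    then obtain a b c where z: "z = (a, b, c)" and abc: "a \<in> X" "b \<in> X" "c \<in> X" by auto
    consider "z \<in> ?S" | "(c, a, b) \<in> ?S" | "(b, c, a) \<in> ?S" using total[OF abc] z abc by auto
    then show "z \<in> ?S \<union> (?f ` ?S \<union> ?g ` ?S)"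
    proof cases
      case 1
      then show ?thesis by (rule UnI1)
    next
      case 2
      then have "?f (c, a, b) \<in> ?f ` ?S" by (rule imageI)
      then show ?thesis unfolding z by simp
    next
      case 3
      then have "?g (b, c, a) \<in> ?g ` ?S" by (rule imageI)
      then show ?thesis unfolding z by simp
    qed
  qed
  then have "card (X \<times> X \<times> X) \<le> card (?S \<union> (?f ` ?S \<union> ?g ` ?S))"
    using finS by (intro card_mono) auto
  also have "\<dots> \<le> card ?S + (card (?f ` ?S) + card (?g ` ?S))"
    by (meson card_Un_le add_le_mono le_refl le_trans)
  also have "\<dots> \<le> 3 * card ?S"
    using card_image_le[OF finS, of ?f] card_image_le[OF finS, of ?g] by simp
  finally show ?thesis by (simp add: card_cartesian_product power3_eq_cube mult.assoc)
qed

text \<open>Convexity keeps the vertices between two members inside the part; the least element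
  plays the role of a root, from which the search for a balanced vertex starts.\<close>

definition convex_part :: "('v \<times> 'v) set \<Rightarrow> 'v set \<Rightarrow> bool" where
  "convex_part R P \<longleftrightarrow> (\<forall>a\<in>P. \<forall>b\<in>P. \<forall>c. (a, c) \<in> R \<longrightarrow> (c, b) \<in> R \<longrightarrow> c \<in> P) \<and>
     (\<exists>y\<in>P. \<forall>u\<in>P. (y, u) \<in> R)"

text \<open>The default value \<open>v\<close> keeps the pivot in \<open>P\<close> when there is no suitable vertex.\<close>

fun pivot :: "('v \<times> 'v) set \<Rightarrow> 'v \<times> 'v \<times> 'v \<Rightarrow> 'v set \<Rightarrow> 'v" where
  "pivot Q (v, w, w') P =
    (if \<exists>x\<in>P. (x, v) \<in> Q \<and> (x, w) \<in> Q \<and> (x, w') \<notin> Q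
     then SOME x. x \<in> P \<and> (x, v) \<in> Q \<and> (x, w) \<in> Q \<and> (x, w') \<notin> Q else v)"

lemma pivot_in: "\<tau> \<in> P \<times> P \<times> P \<Longrightarrow> pivot Q \<tau> P \<in> P"
  by (cases \<tau>) (auto intro: someI2)

lemma pivot_separates:
  assumes "x \<in> P" "(x, v) \<in> Q" "(x, w) \<in> Q" "(x, w') \<notin> Q"
  shows "(pivot Q (v, w, w') P, v) \<in> Q" "(pivot Q (v, w, w') P, w) \<in> Q"
    "(pivot Q (v, w, w') P, w') \<notin> Q"
proof -
  let ?C = "\<lambda>x. x \<in> P \<and> (x, v) \<in> Q \<and> (x, w) \<in> Q \<and> (x, w') \<notin> Q"
  have "?C x" using assms by blast
  then have "?C (SOME x. ?C x)" by (rule someI)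
  moreover have "pivot Q (v, w, w') P = (SOME x. ?C x)" using assms by auto
  ultimately show "(pivot Q (v, w, w') P, v) \<in> Q" "(pivot Q (v, w, w') P, w) \<in> Q"
    "(pivot Q (v, w, w') P, w') \<notin> Q" by simp_all
qed

declare pivot.simps [simp del]

section \<open>Common ancestors of three vertices\<close>

context almost_tree_order
begin

text \<open>Equivalently, the common ancestors of \<open>v\<close> with \<open>w\<close> and those
  of \<open>v\<close> with \<open>u\<close> are comparable under inclusion. In a tree this always
  holds; here it can fail only for \<open>v\<close> below \<open>t\<close>.\<close>

definition nested :: "'v \<Rightarrow> 'v \<Rightarrow> 'v \<Rightarrow> bool" where
  "nested v w u \<longleftrightarrow> anc R v \<inter> anc R w \<subseteq> anc R u \<or> anc R v \<inter> anc R u \<subseteq> anc R w"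

text \<open>Witnesses \<open>a\<close> and \<open>b\<close> against the two inclusions cannot be
  comparable, since the upper one would carry the other one to the vertex that it misses.\<close>

lemma nestedI:
  assumes "\<And>a b. (a, v) \<in> R \<Longrightarrow> (a, w) \<in> R \<Longrightarrow> (a, u) \<notin> R \<Longrightarrow>
    (b, v) \<in> R \<Longrightarrow> (b, u) \<in> R \<Longrightarrow> (b, w) \<notin> R \<Longrightarrow> (a, b) \<in> R \<or> (b, a) \<in> R"
  shows "nested v w u"
proof (rule ccontr)
  assume "\<not> nested v w u"
  then obtain a b where ab: "(a, v) \<in> R" "(a, w) \<in> R" "(a, u) \<notin> R"
    "(b, v) \<in> R" "(b, u) \<in> R" "(b, w) \<notin> R"
    unfolding nested_def subset_iff Int_iff mem_anc by blast
  from assms[OF ab] show False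
    using ab R_trans[of a b u] R_trans[of b a w] by blast
qed

lemma nested_outside: "(t, v) \<notin> R \<Longrightarrow> nested v w u"
  by (rule nestedI) (rule chain_outside)

text \<open>An ancestor of \<open>v\<close> that is not below \<open>t\<close> is above
  \<open>t\<close>, hence above all three vertices, and refutes no inclusion. So both witnesses lie
  below \<open>t\<close>, where ancestors form a chain.\<close>

lemma nested_inside:
  assumes "(t, v) \<in> R" "(t, w) \<in> R" "(t, u) \<in> R"
  shows "nested v w u"
proof (rule nestedI)
  fix a b
  assume ab: "(a, v) \<in> R" "(a, w) \<in> R" "(a, u) \<notin> R" "(b, v) \<in> R" "(b, u) \<in> R" "(b, w) \<notin> R"
  have "(t, a) \<in> R" using enter_via_t[of a v] ab assms R_trans[of a t u] by blast
  moreover have "(t, b) \<in> R" using enter_via_t[of b v] ab assms R_trans[of b t w] by blast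
  ultimately show "(a, b) \<in> R \<or> (b, a) \<in> R" using chain_inside ab by blast
qed

text \<open>Either one of the three vertices is not below \<open>t\<close>, and a rotation moves it
  to the position of \<open>v\<close>, or all three are below \<open>t\<close>.\<close>

lemma three_point:
  "anc R v \<inter> anc R w \<subseteq> anc R u \<or> anc R w \<inter> anc R u \<subseteq> anc R v \<or> anc R u \<inter> anc R v \<subseteq> anc R w"
proof -
  have "nested v w u \<or> nested w u v \<or> nested u v w"
    using nested_outside nested_inside by blast
  then show ?thesis unfolding nested_def by blast
qed

lemma nested_if_same_colour:
  obtains col :: "'v \<Rightarrow> bool" where "\<And>w u. col w = col u \<Longrightarrow> nested v w u"
proof (cases "(t, v) \<in> R")
  case False
  then show thesis using that[of "\<lambda>_. True"] nested_outside by blast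
next
  case v: True
  \<comment> \<open>One colour collects the vertices not below \<open>t\<close> whose common
    ancestors with \<open>v\<close> all lie above \<open>s\<close>. The other collects those not
    below \<open>t\<close> that meet \<open>v\<close> above \<open>p\<close>, and also the vertices
    below \<open>t\<close>, for which nesting holds against every vertex.\<close>
  define col where "col w \<longleftrightarrow> (t, w) \<notin> R \<and> anc R v \<inter> anc R w \<subseteq> anc R s" for w
  have above: "(a, t) \<in> R" "(a, s) \<in> R \<or> (a, p) \<in> R"
    if "(a, v) \<in> R" "(a, w) \<in> R" "(t, w) \<notin> R" for a w
  proof -
    have "(t, a) \<notin> R" using that R_trans[of t a w] by blast
    then show "(a, t) \<in> R" using enter_via_t that v by blast
    then show "(a, s) \<in> R \<or> (a, p) \<in> R" using above_t \<open>(t, a) \<notin> R\<close> by blast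
  qed
  have chain_s: "(a, b) \<in> R \<or> (b, a) \<in> R" if "(a, s) \<in> R" "(b, s) \<in> R" for a b
    using chain_outside that t_above by blast
  have chain_p: "(a, b) \<in> R \<or> (b, a) \<in> R" if "(a, p) \<in> R" "(b, p) \<in> R" for a b
    using chain_outside that t_above by blast
  \<comment> \<open>A single common ancestor that is not above \<open>s\<close> puts all the others
    above \<open>p\<close> as well, because the ancestors of \<open>w\<close> form a chain.\<close>
  have in_p: "(a, p) \<in> R" if a: "(a, v) \<in> R" "(a, w) \<in> R" and w: "(t, w) \<notin> R" "\<not> col w" for a w
  proof -
    obtain b where b: "(b, v) \<in> R" "(b, w) \<in> R" "(b, s) \<notin> R" using w unfolding col_def subset_iff Int_iff mem_anc by blast
    then have "(b, p) \<in> R" using above w by blast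
    moreover have "(a, b) \<in> R \<or> (b, a) \<in> R" using chain_outside a b w by blast
    ultimately show ?thesis
      using above(2)[OF a w(1)] b R_trans[of a b p] R_trans[of b a s] by blast
  qed
  have "nested v w u" if same: "col w = col u" for w u
  proof (cases "(t, w) \<in> R \<or> (t, u) \<in> R")
    case False
    show ?thesis
    proof (cases "col w")
      case True
      then show ?thesis using same by (intro nestedI chain_s) (auto simp: col_def)
    next
      case False': False
      then show ?thesis using same False by (intro nestedI chain_p) (auto intro: in_p)
    qed
  next
    case True
    show ?thesis
    proof (cases "(t, w) \<in> R \<and> (t, u) \<in> R")
      case True
      then show ?thesis using nested_inside v by blast
    next
      case False
      then show ?thesis
      proof (cases "(t, u) \<in> R")
        case True
        then have "anc R v \<inter> anc R w \<subseteq> anc R u"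
          using False above(1)[of _ w] R_trans[of _ t u] by auto
        then show ?thesis by (simp add: nested_def)
      next
        case u: False
        then have "anc R v \<inter> anc R u \<subseteq> anc R w"
          using \<open>(t, w) \<in> R \<or> (t, u) \<in> R\<close> above(1)[of _ u] R_trans[of _ t w] by auto
        then show ?thesis by (simp add: nested_def)
      qed
    qed
  qed
  then show thesis by (rule that)
qed

section \<open>A balanced vertex and the expected gain of a split\<close>

lemma finite_anc: "finite (anc R u)"
  by (rule finite_subset[OF _ finite_V]) (use R_subset in auto)

lemma finite_covers: "finite (covers R a)"
  by (rule finite_subset[OF _ finite_V]) (use R_subset in \<open>auto simp: covers_def\<close>)

text \<open>The number of ancestors serves as a rank for selecting highest and lowest
  vertices.\<close>

lemma card_anc_less:
  assumes "(a, b) \<in> R" "a \<noteq> b"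
  shows "card (anc R a) < card (anc R b)"
proof (rule psubset_card_mono[OF finite_anc])
  have "b \<in> V" using assms R_subset by blast
  then have "b \<in> anc R b" "b \<notin> anc R a" using R_refl R_antisym assms by auto
  moreover have "anc R a \<subseteq> anc R b" using R_trans assms by auto
  ultimately show "anc R a \<subset> anc R b" by blast
qed

lemma cover_exists:
  assumes "(a, x) \<in> R" "a \<noteq> x"
  shows "\<exists>c\<in>covers R a. (c, x) \<in> R"
proof -
  let ?C = "\<lambda>c. (a, c) \<in> R \<and> a \<noteq> c \<and> (c, x) \<in> R"
  have "x \<in> V" using assms R_subset by blast
  then have "?C x" using assms R_refl by blast
  then obtain c where c: "?C c" and least: "\<And>b. ?C b \<Longrightarrow> card (anc R c) \<le> card (anc R b)"
    using ex_has_least_nat[of ?C x "\<lambda>c. card (anc R c)"] by blast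
  have False if "(a, b) \<in> R" "(b, c) \<in> R" "b \<noteq> a" "b \<noteq> c" for b
    using least[of b] card_anc_less[of b c] that c R_trans[of b c x] by fastforce
  then show ?thesis using c by (auto simp: covers_def)
qed

text \<open>Take a vertex \<open>a\<close> of largest rank that has more than half of the part below
  it. Its covers in the part, at most \<open>d\<close> many, have at most half below them, and their
  descendants together with \<open>a\<close> are all that lies below \<open>a\<close>. If each had
  less than a fraction \<open>1 / (8 * d)\<close> of the part below it, together they would have at
  most an eighth, too little even after adding \<open>a\<close>.\<close>

lemma balanced_branch_exists:
  assumes "P \<subseteq> V" and P: "convex_part R P" and two: "card P \<ge> 2"
  shows "\<exists>c\<in>P. card P \<le> 8 * d * card {u \<in> P. (c, u) \<in> R} \<and> 2 * card {u \<in> P. (c, u) \<in> R} \<le> card P"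
proof (rule ccontr)
  let ?D = "\<lambda>c. {u \<in> P. (c, u) \<in> R}"
  assume "\<not> ?thesis"
  then have none: "8 * d * card (?D c) < card P" if "c \<in> P" "2 * card (?D c) \<le> card P" for c
    using that by (meson not_less)
  have finP: "finite P" using finite_subset assms finite_V by blast
  let ?H = "\<lambda>a. a \<in> P \<and> card P < 2 * card (?D a)"
  obtain y where y: "y \<in> P" "\<forall>u\<in>P. (y, u) \<in> R" using P unfolding convex_part_def by blast
  then have "?D y = P" by auto
  then have "?H y" using y two by simp
  moreover have "\<forall>a. ?H a \<longrightarrow> card (anc R a) < Suc H"
    using card_anc assms(1) by (auto simp: less_Suc_eq_le)
  ultimately obtain a where a: "?H a" and max: "\<And>b. ?H b \<Longrightarrow> card (anc R b) \<le> card (anc R a)"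
    using ex_has_greatest_nat[of ?H y "\<lambda>a. card (anc R a)" "Suc H"] by blast
  let ?K = "covers R a \<inter> P"
  have small: "2 * card (?D c) \<le> card P" if "c \<in> ?K" for c
    using max[of c] card_anc_less[of a c] that by (force simp: covers_def)
  have "?D a \<subseteq> insert a (\<Union>c\<in>?K. ?D c)"
  proof
    fix u assume u: "u \<in> ?D a"
    show "u \<in> insert a (\<Union>c\<in>?K. ?D c)"
    proof (cases "u = a")
      case False
      then obtain c where c: "c \<in> covers R a" "(c, u) \<in> R" using cover_exists u by blast
      then have "c \<in> P" using u a P unfolding convex_part_def covers_def by blast
      then show ?thesis using c u by blast
    qed simp
  qed
  then have "card (?D a) \<le> card (insert a (\<Union>c\<in>?K. ?D c))"
    using finP finite_covers by (intro card_mono) auto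
  also have "\<dots> \<le> Suc (card (\<Union>c\<in>?K. ?D c))" by (rule card_insert_le_m1) auto
  also have "card (\<Union>c\<in>?K. ?D c) \<le> (\<Sum>c\<in>?K. card (?D c))"
    using finP by (intro card_UN_le) auto
  finally have 1: "card (?D a) \<le> Suc (\<Sum>c\<in>?K. card (?D c))" by simp
  have "8 * d * (\<Sum>c\<in>?K. card (?D c)) = (\<Sum>c\<in>?K. 8 * d * card (?D c))"
    by (rule sum_distrib_left)
  also have "\<dots> \<le> (\<Sum>c\<in>?K. card P)"
    using none small by (intro sum_mono less_imp_le) auto
  also have "\<dots> \<le> d * card P"
    using card_mono[OF finite_covers, of ?K a] card_covers[of a] a assms(1) by (auto intro!: mult_right_mono)
  finally have "d * (8 * (\<Sum>c\<in>?K. card (?D c))) \<le> d * card P"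
    by (simp only: mult.assoc mult.left_commute)
  then have "8 * (\<Sum>c\<in>?K. card (?D c)) \<le> card P \<or> d = 0" by (simp only: mult_le_cancel1) blast
  \<comment> \<open>Without covers only \<open>a\<close> itself lies below \<open>a\<close>, which
    is not more than half of a part with two vertices.\<close>
  moreover have "d \<noteq> 0"
  proof
    assume "d = 0"
    then have "covers R a = {}" using card_covers[of a] a assms(1) finite_covers by auto
    then show False using 1 a two by simp
  qed
  ultimately show False using 1 a two by simp
qed

text \<open>Division by \<open>card P ^ 3\<close> turns the sum into the expected number of
  separated pairs. The constant is \<open>8 ^ 3 * 2 ^ 2 * 3 * 4\<close>: three vertices are drawn
  from \<open>C\<close> and two from \<open>C'\<close>, a third of the triples qualifies by rotation
  and a quarter of the pairs by colouring.\<close>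

lemma pivot_splits_on_average:
  assumes PV: "P \<subseteq> V" and P: "convex_part R P" and two: "card P \<ge> 2"
  shows "card P ^ 5 \<le> 24576 * d ^ 3 * (\<Sum>\<tau>\<in>P \<times> P \<times> P.
    card {u \<in> P. (pivot R \<tau> P, u) \<in> R} * card {u \<in> P. (pivot R \<tau> P, u) \<notin> R})"
proof -
  have finP: "finite P" using finite_subset PV finite_V by blast
  obtain c where c: "c \<in> P" "card P \<le> 8 * d * card {u \<in> P. (c, u) \<in> R}"
    "2 * card {u \<in> P. (c, u) \<in> R} \<le> card P"
    using balanced_branch_exists[OF assms] by blast
  define C where "C = {u \<in> P. (c, u) \<in> R}"
  define C' where "C' = P - C"
  have fin: "finite C" "finite C'" using finP by (auto simp: C_def C'_def)
  have "card C' = card P - card C" using finP by (auto simp: C_def C'_def card_Diff_subset)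
  then have C': "card P \<le> 2 * card C'" using c(3) by (simp add: C_def)
  let ?x = "\<lambda>\<tau>. pivot R \<tau> P"
  let ?D = "\<lambda>\<tau>. {u \<in> P. (?x \<tau>, u) \<in> R}" and ?N = "\<lambda>\<tau>. {u \<in> P. (?x \<tau>, u) \<notin> R}"
  let ?T = "{(v, w, u) \<in> C \<times> C \<times> C. anc R v \<inter> anc R w \<subseteq> anc R u}"
  let ?W = "\<lambda>v. {(w', u') \<in> C' \<times> C'. anc R v \<inter> anc R u' \<subseteq> anc R w'}"
  have T: "card C ^ 3 \<le> 3 * card ?T"
    by (rule card_triples_cyclic[OF fin(1)]) (rule three_point)
  have W: "card C' ^ 2 \<le> 4 * card (?W v)" for v
  proof -
    obtain col :: "'v \<Rightarrow> bool" where "\<And>w u. col w = col u \<Longrightarrow> nested v w u"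
      using nested_if_same_colour by blast
    then show ?thesis
      by (intro card_two_coloured_pairs[OF fin(2), of col]) (auto simp: nested_def)
  qed
  \<comment> \<open>The vertex \<open>c\<close> shows that a pivot for \<open>(v, w, w')\<close>
    exists. Any such pivot is above \<open>v\<close> and \<open>w\<close>, hence above
    \<open>u\<close>; it is above \<open>v\<close> but not \<open>w'\<close>, hence not above
    \<open>u'\<close>. So each tuple in \<open>?A\<close> yields a draw \<open>(v, w, w')\<close>
    together with a pair \<open>(u, u')\<close> that it separates.\<close>
  let ?A = "Sigma ?T (\<lambda>(v, w, u). ?W v)"
  let ?B = "Sigma (P \<times> P \<times> P) (\<lambda>\<tau>. ?D \<tau> \<times> ?N \<tau>)"
  let ?f = "\<lambda>((v, w, u), (w', u')). ((v, w, w'), (u, u'))"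
  have "?f ` ?A \<subseteq> ?B"
  proof
    fix z assume "z \<in> ?f ` ?A"
    then obtain v w u w' u' where z: "z = ((v, w, w'), (u, u'))"
      and *: "v \<in> C" "w \<in> C" "u \<in> C" "anc R v \<inter> anc R w \<subseteq> anc R u"
        "w' \<in> C'" "u' \<in> C'" "anc R v \<inter> anc R u' \<subseteq> anc R w'"
      by auto
    then have mem: "v \<in> P" "w \<in> P" "u \<in> P" "w' \<in> P" "u' \<in> P"
      and cR: "(c, v) \<in> R" "(c, w) \<in> R" "(c, w') \<notin> R"
      by (auto simp: C_def C'_def)
    note sep = pivot_separates[of c P v R w w', OF c(1) cR]
    have "(?x (v, w, w'), u) \<in> R" using sep * by (auto simp: subset_iff)
    moreover have "(?x (v, w, w'), u') \<notin> R" using sep * by (auto simp: subset_iff)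
    ultimately show "z \<in> ?B" using z mem by simp
  qed
  moreover have "inj_on ?f ?A" by (auto simp: inj_on_def)
  moreover have finB: "finite ?B" using finP by (intro finite_SigmaI) auto
  ultimately have AB: "card ?A \<le> card ?B" using card_inj_on_le by blast
  have cardB: "card ?B = (\<Sum>\<tau>\<in>P \<times> P \<times> P. card (?D \<tau>) * card (?N \<tau>))"
    using finP by (subst card_SigmaI) (auto simp: card_cartesian_product)
  have finT: "finite ?T" using fin by (auto intro: finite_subset[of _ "C \<times> C \<times> C"])
  have finW: "finite (?W v)" for v using fin by (auto intro: finite_subset[of _ "C' \<times> C'"])
  have "card ?A = (\<Sum>(v, w, u)\<in>?T. card (?W v))"
    using finT finW by (subst card_SigmaI) (auto simp: split_def)
  then have "4 * card ?A = (\<Sum>(v, w, u)\<in>?T. 4 * card (?W v))"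
    by (simp add: sum_distrib_left split_def)
  also have "\<dots> \<ge> (\<Sum>(v, w, u)\<in>?T. card C' ^ 2)"
    using W by (intro sum_mono) (auto simp: split_def)
  finally have A: "card ?T * card C' ^ 2 \<le> 4 * card ?A" by (simp add: split_def)
  have "card P ^ 5 = card P ^ 3 * card P ^ 2" by (simp flip: power_add)
  also have "\<dots> \<le> (8 * d * card C) ^ 3 * (2 * card C') ^ 2"
    using c(2) C' by (intro mult_mono power_mono) (auto simp: C_def)
  also have "\<dots> = 2048 * d ^ 3 * (card C ^ 3 * card C' ^ 2)"
    by (simp add: power_mult_distrib)
  also have "\<dots> \<le> 2048 * d ^ 3 * (3 * card ?T * card C' ^ 2)"
    using T by (intro mult_left_mono mult_right_mono) auto
  also have "3 * card ?T * card C' ^ 2 \<le> 12 * card ?B"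
    using A AB by linarith
  then have "2048 * d ^ 3 * (3 * card ?T * card C' ^ 2) \<le> 2048 * d ^ 3 * (12 * card ?B)"
    by (rule mult_left_mono) simp
  finally show ?thesis unfolding cardB by simp
qed

end

section \<open>What is known after splitting\<close>

text \<open>Removing the empty set keeps the result a partition when the whole part lies below its
  pivot.\<close>

definition refine :: "('v \<times> 'v) set \<Rightarrow> ('v set \<Rightarrow> 'v) \<Rightarrow> 'v set set \<Rightarrow> 'v set set" where
  "refine Q x \<pi> =
    (\<Union>P\<in>\<pi>. {{u \<in> P. (x P, u) \<in> Q}, {u \<in> P. (x P, u) \<notin> Q}}) - {{}}"

text \<open>Excluding \<open>a = x P\<close> keeps the known pairs disjoint from those within a part of the refined
  partition.\<close>

definition through :: "('v \<times> 'v) set \<Rightarrow> ('v set \<Rightarrow> 'v) \<Rightarrow> 'v set set \<Rightarrow> ('v \<times> 'v) set" where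
  "through Q x \<pi> =
    {(a, u). \<exists>P\<in>\<pi>. a \<in> P \<and> u \<in> P \<and> a \<noteq> x P \<and> (a, x P) \<in> Q \<and> (x P, u) \<in> Q}"

text \<open>Children have to be recognised from the known pairs alone: \<open>c\<close> extends the
  known ancestors of \<open>a\<close> by just itself. The condition \<open>(c, a) \<notin> K\<close>
  excludes \<open>c = a\<close> for reflexive \<open>K\<close>.\<close>

definition child_queries :: "('v \<times> 'v) set \<Rightarrow> ('v \<times> 'v) set" where
  "child_queries K =
    {(c, u). \<exists>a. (a, u) \<in> K \<and> (c, a) \<notin> K \<and> anc K c = insert c (anc K a)}"

definition top_of :: "('v \<times> 'v) set \<Rightarrow> 'v set \<Rightarrow> 'v" where
  "top_of K D = (SOME x. x \<in> D \<and> (\<forall>u\<in>D. (x, u) \<in> K))"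

lemma partition_on_unique:
  assumes "partition_on V \<pi>" "P \<in> \<pi>" "P' \<in> \<pi>" "a \<in> P" "a \<in> P'"
  shows "P = P'"
  using assms partition_onD2[OF assms(1)] by (auto simp: disjoint_def)

lemma refine_cases:
  assumes "X \<in> refine Q x \<pi>"
  obtains P where "P \<in> \<pi>" "X = {u \<in> P. (x P, u) \<in> Q} \<or> X = {u \<in> P. (x P, u) \<notin> Q}" "X \<noteq> {}"
  using assms unfolding refine_def by blast

lemma partition_on_refine:
  assumes \<pi>: "partition_on V \<pi>"
  shows "partition_on V (refine Q x \<pi>)"
proof (rule partition_onI)
  show "\<Union> (refine Q x \<pi>) = V"
  proof
    show "\<Union> (refine Q x \<pi>) \<subseteq> V"
      using partition_onD1[OF \<pi>] by (auto elim!: refine_cases)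
    show "V \<subseteq> \<Union> (refine Q x \<pi>)"
    proof
      fix u assume "u \<in> V"
      then obtain P where P: "P \<in> \<pi>" "u \<in> P" using partition_onD1[OF \<pi>] by blast
      show "u \<in> \<Union> (refine Q x \<pi>)"
      proof (cases "(x P, u) \<in> Q")
        case True
        then have "{u \<in> P. (x P, u) \<in> Q} \<in> refine Q x \<pi>" using P by (auto simp: refine_def)
        then show ?thesis using True P by blast
      next
        case False
        then have "{u \<in> P. (x P, u) \<notin> Q} \<in> refine Q x \<pi>" using P by (auto simp: refine_def)
        then show ?thesis using False P by blast
      qed
    qed
  qed
  show "disjnt X Y" if XY: "X \<in> refine Q x \<pi>" "Y \<in> refine Q x \<pi>" "X \<noteq> Y" for X Y
  proof -
    obtain P where P: "P \<in> \<pi>" "X = {u \<in> P. (x P, u) \<in> Q} \<or> X = {u \<in> P. (x P, u) \<notin> Q}"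
      using XY(1) by (blast elim: refine_cases)
    obtain P' where P': "P' \<in> \<pi>" "Y = {u \<in> P'. (x P', u) \<in> Q} \<or> Y = {u \<in> P'. (x P', u) \<notin> Q}"
      using XY(2) by (blast elim: refine_cases)
    show ?thesis
    proof (cases "P = P'")
      case True
      then show ?thesis using P P' XY(3) by (auto simp: disjnt_def)
    next
      case False
      then have "P \<inter> P' = {}" using partition_on_unique[OF \<pi> P(1) P'(1)] by blast
      then show ?thesis using P P' by (auto simp: disjnt_def)
    qed
  qed
  show "{} \<notin> refine Q x \<pi>" by (simp add: refine_def)
qed

section \<open>Lost pairs and the invariant of the splitting phase\<close>

context almost_tree_order
begin

text \<open>Related pairs inside a common part are still undecided and do not count as
  missing.\<close>

definition missing :: "'v set set \<Rightarrow> ('v \<times> 'v) set \<Rightarrow> ('v \<times> 'v) set" where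
  "missing \<pi> K = {(a, u) \<in> R. (a, u) \<notin> K \<and> \<not> (\<exists>P\<in>\<pi>. a \<in> P \<and> u \<in> P)}"

text \<open>Splitting \<open>P\<close> at \<open>x\<close> puts \<open>u\<close> below
  \<open>x\<close> and leaves \<open>a\<close> outside; since \<open>a\<close> is not above
  \<open>x\<close>, the pair is not recorded by \<open>through\<close> either.\<close>

definition lost :: "'v set \<Rightarrow> 'v \<Rightarrow> ('v \<times> 'v) set" where
  "lost P x = {(a, u). a \<in> P \<and> u \<in> P \<and> (a, u) \<in> R \<and> (x, u) \<in> R \<and> (a, x) \<notin> R \<and> (x, a) \<notin> R}"

definition branches :: "'v \<Rightarrow> 'v \<Rightarrow> bool" where
  "branches y y' \<longleftrightarrow> y = s \<and> y' = p \<or> y = p \<and> y' = s"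

definition branch_gap :: "('v \<times> 'v) set \<Rightarrow> 'v set \<Rightarrow> bool" where
  "branch_gap M D \<longleftrightarrow> t \<in> D \<and> D \<subseteq> {u. (t, u) \<in> R} \<and>
    (\<exists>y y'. branches y y' \<and> M = (anc R y - anc R y') \<times> D)"

text \<open>Once pairs are missing, no part contains all of \<open>s\<close>, \<open>p\<close>,
  \<open>t\<close>; this rules out a second loss.\<close>

definition state_ok :: "'v set set \<Rightarrow> ('v \<times> 'v) set \<Rightarrow> bool" where
  "state_ok \<pi> K \<longleftrightarrow> partition_on V \<pi> \<and> (\<forall>P\<in>\<pi>. convex_part R P) \<and> K \<subseteq> R \<and>
    (\<forall>P\<in>\<pi>. K \<inter> P \<times> P = {}) \<and>
    (missing \<pi> K = {} \<or>
      (\<exists>D. branch_gap (missing \<pi> K) D) \<and> (\<forall>P\<in>\<pi>. \<not> {s, p, t} \<subseteq> P))"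

lemma branchesD:
  assumes "branches y y'"
  shows "(y, t) \<in> R" "(y', t) \<in> R" "(t, y) \<notin> R" "(t, y') \<notin> R" "(y, y') \<notin> R" "(y', y) \<notin> R"
  using assms t_above sp_incomp by (auto simp: branches_def)

lemma R_in_V: "(a, b) \<in> R \<Longrightarrow> a \<in> V" "(a, b) \<in> R \<Longrightarrow> b \<in> V"
  using R_subset by auto

lemma t_refl: "(t, t) \<in> R"
  using R_refl R_in_V t_above by blast

text \<open>Two incomparable ancestors \<open>a\<close> and \<open>x\<close> of \<open>u\<close>
  force \<open>u\<close> below \<open>t\<close>. Neither of them is below \<open>t\<close>, since
  the other would then be comparable to it, inside the chain below \<open>t\<close> or through
  \<open>t\<close>. So both are properly above \<open>t\<close>, and they cannot share a branch
  because the ancestors of \<open>s\<close>, and those of \<open>p\<close>, form chains.\<close>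

lemma lost_pair:
  assumes "(a, u) \<in> lost P x"
  shows "(t, u) \<in> R" "\<exists>y y'. branches y y' \<and> (a, y) \<in> R \<and> (a, y') \<notin> R \<and> (x, y') \<in> R \<and> (x, y) \<notin> R"
proof -
  from assms have *: "(a, u) \<in> R" "(x, u) \<in> R" "(a, x) \<notin> R" "(x, a) \<notin> R"
    by (auto simp: lost_def)
  show tu: "(t, u) \<in> R" using chain_outside * by blast
  have ta: "(t, a) \<notin> R"
    using chain_inside[of a u x] enter_via_t[of x u] R_trans[of x t a] * tu by blast
  have tx: "(t, x) \<notin> R"
    using chain_inside[of a u x] enter_via_t[of a u] R_trans[of a t x] * tu by blast
  have "(a, s) \<in> R \<or> (a, p) \<in> R" "(x, s) \<in> R \<or> (x, p) \<in> R"
    using enter_via_t[OF _ tu] above_t ta tx * t_refl by blast+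
  moreover have "\<not> ((a, s) \<in> R \<and> (x, s) \<in> R)" "\<not> ((a, p) \<in> R \<and> (x, p) \<in> R)"
    using chain_outside[of a _ x] * t_above by blast+
  ultimately show "\<exists>y y'. branches y y' \<and> (a, y) \<in> R \<and> (a, y') \<notin> R \<and> (x, y') \<in> R \<and> (x, y) \<notin> R"
    unfolding branches_def by blast
qed

text \<open>A single lost pair determines on which branch \<open>x\<close> lies, and then the whole
  opposite branch is lost towards everything in \<open>P\<close> below \<open>t\<close>. Convexity
  brings \<open>t\<close> and both of its parents into \<open>P\<close>.\<close>

lemma lost_structure:
  assumes P: "convex_part R P" and x: "x \<in> P" and "lost P x \<noteq> {}"
  obtains y y' where "branches y y'" "lost P x = (anc R y - anc R y') \<times> {u \<in> P. (t, u) \<in> R}"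
    "{s, p, t} \<subseteq> P" "(x, y') \<in> R" "(x, y) \<notin> R"
proof -
  from assms(3) obtain a u where au: "(a, u) \<in> lost P x" by auto
  then have auP: "a \<in> P" "u \<in> P" by (auto simp: lost_def)
  note tu = lost_pair(1)[OF au]
  from lost_pair(2)[OF au] obtain y y' where br: "branches y y'"
    and ay: "(a, y) \<in> R" "(a, y') \<notin> R" and xy: "(x, y') \<in> R" "(x, y) \<notin> R" by blast
  note yy = branchesD[OF br]
  have conv: "c \<in> P" if "a \<in> P" "b \<in> P" "(a, c) \<in> R" "(c, b) \<in> R" for a b c
    using P that unfolding convex_part_def by blast
  obtain z where z: "z \<in> P" "\<And>u. u \<in> P \<Longrightarrow> (z, u) \<in> R" using P unfolding convex_part_def by blast
  have tP: "t \<in> P" using conv[OF auP(1,2), of t] R_trans[OF ay(1) yy(1)] tu by blast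
  have "y \<in> P" "y' \<in> P" using conv[OF auP(1) tP ay(1) yy(1)] conv[OF x tP xy(1) yy(2)] by auto
  then have sptP: "{s, p, t} \<subseteq> P" using tP br by (auto simp: branches_def)
  have "lost P x \<subseteq> (anc R y - anc R y') \<times> {u \<in> P. (t, u) \<in> R}"
  proof
    fix e assume e: "e \<in> lost P x"
    obtain b w where bw: "e = (b, w)" by force
    from lost_pair[OF e[unfolded bw]] obtain q q' where
      "(t, w) \<in> R" "branches q q'" "(b, q) \<in> R" "(b, q') \<notin> R" "(x, q') \<in> R" "(x, q) \<notin> R" by blast
    moreover have "w \<in> P" using e bw by (auto simp: lost_def)
    ultimately show "e \<in> (anc R y - anc R y') \<times> {u \<in> P. (t, u) \<in> R}"
      using br xy bw by (auto simp: branches_def)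
  qed
  moreover have "(b, w) \<in> lost P x"
    if b: "(b, y) \<in> R" "(b, y') \<notin> R" and w: "w \<in> P" "(t, w) \<in> R" for b w
  proof -
    have bw: "(b, w) \<in> R" using R_trans[OF R_trans[OF b(1) yy(1)] w(2)] .
    \<comment> \<open>The least element \<open>z\<close> of \<open>P\<close> is above both branches,
      hence above \<open>b\<close>, so convexity puts \<open>b\<close> into
      \<open>P\<close>.\<close>
    have "(z, b) \<in> R \<or> (b, z) \<in> R"
      using chain_outside[OF _ b(1) yy(3), of z] R_trans[OF z(2)[OF auP(1)] ay(1)] by blast
    moreover have "(b, z) \<notin> R" using R_trans[OF _ R_trans[OF z(2)[OF x] xy(1)]] b(2) by blast
    ultimately have "b \<in> P" using conv[OF z(1) w(1) _ bw] by blast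
    moreover have "(x, w) \<in> R" using R_trans[OF R_trans[OF xy(1) yy(2)] w(2)] .
    moreover have "(b, x) \<notin> R" using R_trans[OF _ xy(1)] b(2) by blast
    moreover have "(x, b) \<notin> R" using R_trans[OF _ b(1)] xy(2) by blast
    ultimately show ?thesis using bw w(1) by (auto simp: lost_def)
  qed
  ultimately have "lost P x = (anc R y - anc R y') \<times> {u \<in> P. (t, u) \<in> R}" by auto
  then show thesis using that br sptP xy by blast
qed

lemma convex_part_refine:
  assumes "convex_part R P" "x \<in> P"
    and X: "X = {u \<in> P. (x, u) \<in> R} \<or> X = {u \<in> P. (x, u) \<notin> R}" "X \<noteq> {}"
  shows "convex_part R X"
proof -
  obtain y where y: "y \<in> P" "\<forall>u\<in>P. (y, u) \<in> R"
    and conv: "\<And>a b c. a \<in> P \<Longrightarrow> b \<in> P \<Longrightarrow> (a, c) \<in> R \<Longrightarrow> (c, b) \<in> R \<Longrightarrow> c \<in> P"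
    using assms(1) unfolding convex_part_def by blast
  from X(1) show ?thesis
  proof
    assume X: "X = {u \<in> P. (x, u) \<in> R}"
    have "(x, x) \<in> R" using R_refl R_in_V y assms(2) by blast
    then have bot: "\<exists>y\<in>X. \<forall>u\<in>X. (y, u) \<in> R" using assms(2) X by auto
    have "\<forall>a\<in>X. \<forall>b\<in>X. \<forall>c. (a, c) \<in> R \<longrightarrow> (c, b) \<in> R \<longrightarrow> c \<in> X"
      using conv R_trans[of x] X by blast
    then show ?thesis unfolding convex_part_def using bot by (rule conjI)
  next
    assume X': "X = {u \<in> P. (x, u) \<notin> R}"
    \<comment> \<open>If \<open>x\<close> were above the least element of \<open>P\<close>, all of
      \<open>P\<close> would lie below \<open>x\<close> and \<open>X\<close> would be empty.\<close>
    then have "y \<in> X" using X(2) y R_trans[of x y] by blast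
    then have bot: "\<exists>y\<in>X. \<forall>u\<in>X. (y, u) \<in> R" using y X' by auto
    have "\<forall>a\<in>X. \<forall>b\<in>X. \<forall>c. (a, c) \<in> R \<longrightarrow> (c, b) \<in> R \<longrightarrow> c \<in> X"
      using conv R_trans[of x] X' by blast
    then show ?thesis unfolding convex_part_def using bot by (rule conjI)
  qed
qed

text \<open>A related pair of \<open>P\<close> stays in one part unless only \<open>u\<close> is
  below the pivot; it is then recorded if \<open>a\<close> is above the pivot, and lost
  otherwise.\<close>

lemma missing_refine:
  assumes \<pi>: "partition_on V \<pi>" and K: "\<And>P. P \<in> \<pi> \<Longrightarrow> K \<inter> P \<times> P = {}"
    and x: "\<And>P. P \<in> \<pi> \<Longrightarrow> x P \<in> P"
  shows "missing (refine R x \<pi>) (K \<union> through R x \<pi>) = missing \<pi> K \<union> (\<Union>P\<in>\<pi>. lost P (x P))"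
    (is "?L = ?A \<union> ?B")
proof (intro set_eqI iffI)
  fix e assume e: "e \<in> ?L"
  obtain a u where au: "e = (a, u)" by force
  from e au have *: "(a, u) \<in> R" "(a, u) \<notin> K" "(a, u) \<notin> through R x \<pi>"
    "\<And>X. X \<in> refine R x \<pi> \<Longrightarrow> \<not> (a \<in> X \<and> u \<in> X)" by (auto simp: missing_def)
  show "e \<in> ?A \<union> ?B"
  proof (cases "\<exists>P\<in>\<pi>. a \<in> P \<and> u \<in> P")
    case False
    then show ?thesis using * au by (auto simp: missing_def)
  next
    case True
    then obtain P where P: "P \<in> \<pi>" "a \<in> P" "u \<in> P" by blast
    let ?X = "{u \<in> P. (x P, u) \<in> R}" and ?Y = "{u \<in> P. (x P, u) \<notin> R}"
    have "?X \<noteq> {} \<Longrightarrow> ?X \<in> refine R x \<pi>" "?Y \<noteq> {} \<Longrightarrow> ?Y \<in> refine R x \<pi>"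
      using P(1) unfolding refine_def by blast+
    then have "\<not> (a \<in> ?X \<and> u \<in> ?X)" "\<not> (a \<in> ?Y \<and> u \<in> ?Y)" using *(4) by blast+
    then have "(x P, a) \<notin> R" "(x P, u) \<in> R" using P R_trans[OF _ *(1), of "x P"] by auto
    moreover have "(a, x P) \<notin> R"
    proof
      assume "(a, x P) \<in> R"
      moreover have "a \<noteq> x P" using \<open>(x P, a) \<notin> R\<close> R_refl R_in_V(1)[OF *(1)] by blast
      ultimately show False using *(3) P \<open>(x P, u) \<in> R\<close> by (auto simp: through_def)
    qed
    ultimately have "e \<in> lost P (x P)" using P * au by (auto simp: lost_def)
    then show ?thesis using P by blast
  qed
next
  fix e assume e: "e \<in> ?A \<union> ?B"
  obtain a u where au: "e = (a, u)" by force
  from e show "e \<in> ?L"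
  proof
    assume "e \<in> ?A"
    then have *: "(a, u) \<in> R" "(a, u) \<notin> K" "\<And>P. P \<in> \<pi> \<Longrightarrow> \<not> (a \<in> P \<and> u \<in> P)"
      using au by (auto simp: missing_def)
    then have "(a, u) \<notin> through R x \<pi>" by (auto simp: through_def)
    moreover have "\<not> (a \<in> X \<and> u \<in> X)" if X: "X \<in> refine R x \<pi>" for X
      using X by (rule refine_cases) (use * in auto)
    ultimately show ?thesis using * au by (auto simp: missing_def)
  next
    assume "e \<in> ?B"
    then obtain P where P: "P \<in> \<pi>" and *: "a \<in> P" "u \<in> P" "(a, u) \<in> R" "(x P, u) \<in> R"
      "(a, x P) \<notin> R" "(x P, a) \<notin> R" using au by (auto simp: lost_def)
    have uniq: "P' = P" if "P' \<in> \<pi>" "a \<in> P'" for P'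
      using partition_on_unique[OF \<pi> that(1) P that(2) *(1)] .
    have "(a, u) \<notin> K" using K[OF P] * by blast
    moreover have "(a, u) \<notin> through R x \<pi>" using uniq * by (auto simp: through_def)
    moreover have "\<not> (a \<in> X \<and> u \<in> X)" if X: "X \<in> refine R x \<pi>" for X
      using X by (rule refine_cases) (use * uniq in auto)
    ultimately show ?thesis using * au by (auto simp: missing_def)
  qed
qed

text \<open>A loss requires \<open>s\<close>, \<open>p\<close>, \<open>t\<close> in one part, so it
  occurs in at most one part and only while nothing is missing. The pivot responsible is above
  exactly one of \<open>s\<close> and \<open>p\<close>, so it separates them for good.\<close>

lemma state_ok_step:
  assumes ok: "state_ok \<pi> K" and x: "\<And>P. P \<in> \<pi> \<Longrightarrow> x P \<in> P"
  shows "state_ok (refine R x \<pi>) (K \<union> through R x \<pi>)"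
proof -
  from ok have \<pi>: "partition_on V \<pi>" and conv: "\<And>P. P \<in> \<pi> \<Longrightarrow> convex_part R P"
    and KR: "K \<subseteq> R" and KP: "\<And>P. P \<in> \<pi> \<Longrightarrow> K \<inter> P \<times> P = {}"
    and gap: "missing \<pi> K = {} \<or>
      (\<exists>D. branch_gap (missing \<pi> K) D) \<and> (\<forall>P\<in>\<pi>. \<not> {s, p, t} \<subseteq> P)"
    by (auto simp: state_ok_def)
  let ?\<pi> = "refine R x \<pi>" and ?K = "K \<union> through R x \<pi>"
  have conv': "convex_part R X" if X: "X \<in> ?\<pi>" for X
  proof -
    obtain P where "P \<in> \<pi>" "X = {u \<in> P. (x P, u) \<in> R} \<or> X = {u \<in> P. (x P, u) \<notin> R}" "X \<noteq> {}"
      using X by (rule refine_cases)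
    then show ?thesis using convex_part_refine[OF conv x, of P X] by blast
  qed
  have KP': "?K \<inter> X \<times> X = {}" if X: "X \<in> ?\<pi>" for X
  proof -
    obtain P where P: "P \<in> \<pi>" "X = {u \<in> P. (x P, u) \<in> R} \<or> X = {u \<in> P. (x P, u) \<notin> R}"
      using X by (blast elim: refine_cases)
    have "(a, u) \<notin> through R x \<pi>" if au: "a \<in> X" "u \<in> X" for a u
    proof
      assume "(a, u) \<in> through R x \<pi>"
      then obtain P' where P': "P' \<in> \<pi>" "a \<in> P'" "a \<noteq> x P'" "(a, x P') \<in> R" "(x P', u) \<in> R"
        by (auto simp: through_def)
      have "P' = P" using partition_on_unique[OF \<pi> P'(1) P(1) P'(2)] P(2) au by blast
      then show False using P' P(2) au R_antisym[of a "x P"] by auto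
    qed
    moreover have "X \<subseteq> P" using P(2) by auto
    ultimately show ?thesis using KP[OF P(1)] by blast
  qed
  have miss: "missing ?\<pi> ?K = missing \<pi> K \<union> (\<Union>P\<in>\<pi>. lost P (x P))"
    using missing_refine[OF \<pi> KP x] .
  have "missing ?\<pi> ?K = {} \<or>
      (\<exists>D. branch_gap (missing ?\<pi> ?K) D) \<and> (\<forall>P\<in>?\<pi>. \<not> {s, p, t} \<subseteq> P)"
  proof (cases "\<exists>P\<in>\<pi>. lost P (x P) \<noteq> {}")
    case False
    then have "missing ?\<pi> ?K = missing \<pi> K" using miss by auto
    moreover have "\<not> {s, p, t} \<subseteq> X" if none: "\<forall>P\<in>\<pi>. \<not> {s, p, t} \<subseteq> P" and X: "X \<in> ?\<pi>" for X
      using X by (rule refine_cases) (use none in auto)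
    ultimately show ?thesis using gap by auto
  next
    case True
    then obtain P where P: "P \<in> \<pi>" "lost P (x P) \<noteq> {}" by blast
    obtain y y' where br: "branches y y'"
      and lost: "lost P (x P) = (anc R y - anc R y') \<times> {u \<in> P. (t, u) \<in> R}"
      and sptP: "{s, p, t} \<subseteq> P" and xy: "(x P, y') \<in> R" "(x P, y) \<notin> R"
      using lost_structure[OF conv[OF P(1)] x[OF P(1)] P(2)] .
    have "lost P' (x P') = {}" if P': "P' \<in> \<pi>" "P' \<noteq> P" for P'
    proof (rule ccontr)
      assume ne: "lost P' (x P') \<noteq> {}"
      have "t \<in> P'" by (rule lost_structure[OF conv[OF P'(1)] x[OF P'(1)] ne]) simp
      then show False using partition_on_unique[OF \<pi> P'(1) P(1)] sptP P'(2) by blast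
    qed
    then have "(\<Union>P\<in>\<pi>. lost P (x P)) = lost P (x P)" using P by blast
    moreover have "missing \<pi> K = {}" using gap P(1) sptP by blast
    ultimately have "missing ?\<pi> ?K = (anc R y - anc R y') \<times> {u \<in> P. (t, u) \<in> R}"
      using miss lost by simp
    then have "branch_gap (missing ?\<pi> ?K) {u \<in> P. (t, u) \<in> R}"
      using br sptP t_refl by (auto simp: branch_gap_def)
    moreover have "\<not> {s, p, t} \<subseteq> X" if X: "X \<in> ?\<pi>" for X
    proof
      assume sptX: "{s, p, t} \<subseteq> X"
      obtain P' where P': "P' \<in> \<pi>" "X = {u \<in> P'. (x P', u) \<in> R} \<or> X = {u \<in> P'. (x P', u) \<notin> R}"
        using X by (blast elim: refine_cases)
      then have "P' = P" using partition_on_unique[OF \<pi> P'(1) P(1), of t] sptX sptP by blast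
      then show False using P'(2) sptX xy br by (auto simp: branches_def)
    qed
    ultimately show ?thesis by blast
  qed
  moreover have "through R x \<pi> \<subseteq> R" using R_trans by (auto simp: through_def)
  ultimately show ?thesis
    using partition_on_refine[OF \<pi>] conv' KP' KR unfolding state_ok_def by blast
qed

lemma state_ok_init: "state_ok {V} {}"
proof -
  have "convex_part R V" using root R_in_V by (auto simp: convex_part_def)
  moreover have "missing {V} {} = {}" using R_subset by (auto simp: missing_def)
  moreover have "partition_on V {V}" using root by (intro partition_on_space) auto
  ultimately show ?thesis by (simp add: state_ok_def)
qed

lemma state_ok_final:
  assumes ok: "state_ok \<pi> K" and single: "\<And>P a u. P \<in> \<pi> \<Longrightarrow> a \<in> P \<Longrightarrow> u \<in> P \<Longrightarrow> a = u"
  shows "K \<union> Id_on V \<subseteq> R" "R - (K \<union> Id_on V) = {} \<or> (\<exists>D. branch_gap (R - (K \<union> Id_on V)) D)"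
proof -
  have "K \<subseteq> R" using ok by (simp add: state_ok_def)
  then show "K \<union> Id_on V \<subseteq> R" using R_refl by auto
  have V: "\<Union>\<pi> = V" using ok by (auto simp: state_ok_def partition_on_def)
  have "R - (K \<union> Id_on V) = missing \<pi> K"
  proof (intro set_eqI iffI)
    fix e assume e: "e \<in> R - (K \<union> Id_on V)"
    obtain a u where au: "e = (a, u)" by force
    have "a \<noteq> u" using e au R_in_V(1)[of a u] by auto
    then have "\<not> (a \<in> P \<and> u \<in> P)" if "P \<in> \<pi>" for P using single[OF that] by blast
    then show "e \<in> missing \<pi> K" using e au by (auto simp: missing_def)
  next
    fix e assume e: "e \<in> missing \<pi> K"
    obtain a u where au: "e = (a, u)" by force
    have "a \<noteq> u" using e au V R_in_V(1)[of a u] by (auto simp: missing_def)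
    then show "e \<in> R - (K \<union> Id_on V)" using e au by (auto simp: missing_def)
  qed
  then show "R - (K \<union> Id_on V) = {} \<or> (\<exists>D. branch_gap (R - (K \<union> Id_on V)) D)"
    using ok by (auto simp: state_ok_def)
qed

section \<open>Detecting and repairing the gap\<close>

lemma child_query_cover:
  assumes KR: "K \<subseteq> R" and KV: "Id_on V \<subseteq> K" and gap: "R - K = {} \<or> (\<exists>D. branch_gap (R - K) D)"
    and a: "(a, u) \<in> K" "(c, a) \<notin> K" "anc K c = insert c (anc K a)"
  shows "c \<in> covers R a"
proof -
  have aV: "a \<in> V" using a KR R_in_V by blast
  have mem: "(b, c) \<in> K \<longleftrightarrow> b = c \<or> (b, a) \<in> K" for b
    using a(3) by (metis insert_iff mem_anc)
  have ac: "(a, c) \<in> K" using mem[of a] KV aV by (auto simp: Id_on_def)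
  \<comment> \<open>A vertex \<open>b\<close> strictly between \<open>a\<close> and \<open>c\<close>
    is not a known ancestor of \<open>c\<close>, so \<open>(b, c)\<close> belongs to the gap. The
    known ancestor \<open>t\<close> of \<open>c\<close> is not above \<open>a\<close>, hence
    \<open>c = t\<close>. But then the other parent \<open>y'\<close> of \<open>t\<close> is known
    and must be above \<open>a\<close>, thus above \<open>b\<close> and \<open>y\<close>, which is
    impossible.\<close>
  have False if b: "(a, b) \<in> R" "(b, c) \<in> R" "b \<noteq> a" "b \<noteq> c" for b
  proof -
    have ba: "(b, a) \<notin> R" using b R_antisym by blast
    then have bc: "(b, c) \<in> R - K" using mem[of b] b KR by blast
    then obtain D where D: "branch_gap (R - K) D" using gap by blast
    then obtain y y' where br: "branches y y'" and M: "R - K = (anc R y - anc R y') \<times> D"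
      and tD: "t \<in> D" "D \<subseteq> {u. (t, u) \<in> R}" unfolding branch_gap_def by blast
    note yy = branchesD[OF br]
    have bY: "(b, y) \<in> R" "(b, y') \<notin> R" "c \<in> D" using bc M by auto
    have tb: "(t, b) \<notin> R" using R_trans[OF _ bY(1)] yy by blast
    have ta: "(t, a) \<notin> R" using R_trans[OF _ b(1)] tb by blast
    have tc: "(t, c) \<in> K"
    proof (rule ccontr)
      assume "(t, c) \<notin> K"
      then have "(t, c) \<in> R - K" using bY(3) tD by blast
      then show False using M yy by auto
    qed
    then have "t = c" using mem[of t] ta KR by blast
    have "(y', t) \<in> K"
    proof (rule ccontr)
      assume "(y', t) \<notin> K"
      then have "(y', t) \<in> R - K" using yy by blast
      then show False using M R_refl R_in_V(1)[OF yy(2)] by auto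
    qed
    moreover have "y' \<noteq> t" using yy t_refl by auto
    ultimately have "(y', a) \<in> R" using mem[of y'] \<open>t = c\<close> KR by blast
    then have "(y', y) \<in> R" using R_trans[OF R_trans[OF _ b(1)] bY(1)] by blast
    then show False using yy by blast
  qed
  moreover have "a \<noteq> c" using ac a(2) by blast
  ultimately show ?thesis using ac KR by (auto simp: covers_def)
qed

lemma child_queries_bound:
  assumes KR: "K \<subseteq> R" and KV: "Id_on V \<subseteq> K" and gap: "R - K = {} \<or> (\<exists>D. branch_gap (R - K) D)"
  shows "finite (child_queries K)" "card (child_queries K) \<le> card V * (H * d)"
proof -
  let ?B = "\<lambda>u. \<Union>a\<in>anc R u. (\<lambda>c. (c, u)) ` covers R a"
  have sub: "child_queries K \<subseteq> (\<Union>u\<in>V. ?B u)"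
  proof
    fix e assume "e \<in> child_queries K"
    then obtain c u a where e: "e = (c, u)" "(a, u) \<in> K" "(c, a) \<notin> K" "anc K c = insert c (anc K a)"
      by (auto simp: child_queries_def)
    then have "c \<in> covers R a" using child_query_cover[OF assms] by blast
    moreover have "a \<in> anc R u" using e KR by auto
    ultimately have "e \<in> ?B u" using e(1) by blast
    moreover have "u \<in> V" using e KR R_in_V by blast
    ultimately show "e \<in> (\<Union>u\<in>V. ?B u)" by blast
  qed
  have fin: "finite (?B u)" for u using finite_anc finite_covers by auto
  then show "finite (child_queries K)" using finite_subset[OF sub] finite_V by blast
  have "card (?B u) \<le> H * d" if "u \<in> V" for u
  proof -
    have "card (?B u) \<le> (\<Sum>a\<in>anc R u. card ((\<lambda>c. (c, u)) ` covers R a))"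
      by (rule card_UN_le[OF finite_anc])
    also have "\<dots> \<le> (\<Sum>a\<in>anc R u. d)"
      using card_covers R_in_V card_image_le[OF finite_covers] by (intro sum_mono) (fastforce intro: le_trans)
    also have "\<dots> \<le> H * d" using card_anc[OF that] by simp
    finally show ?thesis .
  qed
  then have "(\<Sum>u\<in>V. card (?B u)) \<le> card V * (H * d)"
    using sum_bounded_above[of V "\<lambda>u. card (?B u)" "H * d"] by simp
  moreover have "card (child_queries K) \<le> card (\<Union>u\<in>V. ?B u)"
    using sub fin finite_V by (intro card_mono) auto
  ultimately show "card (child_queries K) \<le> card V * (H * d)"
    using card_UN_le[OF finite_V, of ?B] by linarith
qed

text \<open>Let \<open>c\<close> be the highest vertex on the lost branch and \<open>a\<close> its
  parent, which is also above \<open>y'\<close>. Then \<open>(a, u)\<close> is known for every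
  \<open>u\<close> in \<open>D\<close>, so \<open>(c, u)\<close> is asked and answered positively
  although it is not known.\<close>

lemma gap_detected:
  assumes KR: "K \<subseteq> R" and KV: "Id_on V \<subseteq> K" and gap: "branch_gap (R - K) D"
  shows "snd ` (child_queries K \<inter> R - K) = D"
proof
  from gap obtain y y' where br: "branches y y'" and M: "R - K = (anc R y - anc R y') \<times> D"
    and tD: "t \<in> D" "D \<subseteq> {u. (t, u) \<in> R}" unfolding branch_gap_def by blast
  note yy = branchesD[OF br]
  have "u \<in> D" if "(c, u) \<in> R - K" for c u using that unfolding M by blast
  then show "snd ` (child_queries K \<inter> R - K) \<subseteq> D" by auto
  have yV: "y \<in> V" "y' \<in> V" using yy R_in_V by blast+
  let ?Y = "\<lambda>c. (c, y) \<in> R \<and> (c, y') \<notin> R"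
  have "?Y y" using yV R_refl yy by blast
  then obtain c where c: "?Y c" and least: "\<And>b. ?Y b \<Longrightarrow> card (anc R c) \<le> card (anc R b)"
    using ex_has_least_nat[of ?Y y "\<lambda>c. card (anc R c)"] by blast
  let ?Z = "\<lambda>a. (a, c) \<in> R \<and> a \<noteq> c"
  have cV: "c \<in> V" using c R_in_V by blast
  have "?Z r" using root(2)[OF cV] root(2)[OF yV(2)] c by auto
  moreover have "\<forall>a. ?Z a \<longrightarrow> card (anc R a) < Suc H"
    using card_anc R_in_V by (auto simp: less_Suc_eq_le)
  ultimately obtain a where a: "?Z a" and greatest: "\<And>b. ?Z b \<Longrightarrow> card (anc R b) \<le> card (anc R a)"
    using ex_has_greatest_nat[of ?Z r "\<lambda>a. card (anc R a)" "Suc H"] by blast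
  have tc: "(t, c) \<notin> R" using c R_trans[of t c y] yy by blast
  have ta: "(t, a) \<notin> R" using a R_trans[of t a c] tc by blast
  have below_a: "(b, a) \<in> R" if b: "?Z b" for b
  proof -
    have "(a, b) \<in> R \<or> (b, a) \<in> R" using chain_outside[of a c b] a b tc by blast
    then show ?thesis using greatest[OF b] card_anc_less[of a b] R_refl R_in_V a by fastforce
  qed
  have R_anc: "anc R c = insert c (anc R a)"
  proof (rule set_eqI)
    fix b show "b \<in> anc R c \<longleftrightarrow> b \<in> insert c (anc R a)"
      using below_a[of b] a R_trans[of b a c] R_refl[OF cV] by auto
  qed
  \<comment> \<open>Missing pairs end below \<open>t\<close>, so the ancestors of any vertex not
    below \<open>t\<close> are completely known.\<close>
  have same: "anc K b = anc R b" if tb: "(t, b) \<notin> R" for b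
  proof -
    have "(x, b) \<notin> R - K" for x using tb tD unfolding M by blast
    then show ?thesis using KR by auto
  qed
  have "(a, y') \<in> R"
    using least[of a] card_anc_less[of a c] a c R_trans[of a c y] by fastforce
  show "D \<subseteq> snd ` (child_queries K \<inter> R - K)"
  proof
    fix u assume u: "u \<in> D"
    have cu: "(c, u) \<in> R - K" unfolding M using c u by simp
    have "(a, u) \<in> R" using a cu R_trans[of a c u] by blast
    moreover have "(a, u) \<notin> R - K" unfolding M using \<open>(a, y') \<in> R\<close> by simp
    ultimately have "(a, u) \<in> K" by blast
    moreover have "(c, a) \<notin> K" using KR a R_antisym by blast
    ultimately have "(c, u) \<in> child_queries K"
      using same[OF tc] same[OF ta] R_anc by (auto simp: child_queries_def)
    then have "(c, u) \<in> child_queries K \<inter> R - K" using cu by blast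
    then have "snd (c, u) \<in> snd ` (child_queries K \<inter> R - K)" by (rule imageI)
    then show "u \<in> snd ` (child_queries K \<inter> R - K)" by simp
  qed
qed

text \<open>\<open>t\<close> is recognised as the top of \<open>D\<close>, because no pair starting
  in \<open>t\<close> is missing, and every missing pair leads from an ancestor of \<open>t\<close>
  into \<open>D\<close>. For empty \<open>D\<close> the value of \<open>top_of\<close> is arbitrary,
  but nothing is added.\<close>

lemma gap_repaired:
  assumes KR: "K \<subseteq> R" and KV: "Id_on V \<subseteq> K" and gap: "R - K = {} \<or> (\<exists>D. branch_gap (R - K) D)"
    and D: "D = snd ` (child_queries K \<inter> R - K)"
  shows "K \<union> {(a, u). (a, top_of K D) \<in> (V \<times> {top_of K D}) \<inter> R \<and> u \<in> D} = R"
  using gap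
proof
  assume "R - K = {}"
  then have "D = {}" using D by blast
  then show ?thesis using \<open>R - K = {}\<close> KR by auto
next
  assume "\<exists>D. branch_gap (R - K) D"
  then have bg: "branch_gap (R - K) D" using gap_detected[OF KR KV] D by blast
  then obtain y y' where br: "branches y y'" and M: "R - K = (anc R y - anc R y') \<times> D"
    and tD: "t \<in> D" "D \<subseteq> {u. (t, u) \<in> R}" unfolding branch_gap_def by blast
  note yy = branchesD[OF br]
  have tK: "(t, u) \<in> K" if "u \<in> D" for u
  proof (rule ccontr)
    assume "(t, u) \<notin> K"
    then have "(t, u) \<in> R - K" using that tD by blast
    then show False unfolding M using yy by simp
  qed
  have "top_of K D = t"
    unfolding top_of_def
  proof (rule some_equality)
    show "t \<in> D \<and> (\<forall>u\<in>D. (t, u) \<in> K)" using tD tK by blast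
    show "x = t" if "x \<in> D \<and> (\<forall>u\<in>D. (x, u) \<in> K)" for x
      using that tD KR R_antisym[of x t] by blast
  qed
  moreover have "{(a, u). (a, t) \<in> R \<and> u \<in> D} \<subseteq> R" using tD R_trans by blast
  moreover have "R - K \<subseteq> {(a, u). (a, t) \<in> R \<and> u \<in> D}"
    unfolding M using R_trans[OF _ yy(1)] by auto
  moreover have "R \<subseteq> V \<times> V" by (rule R_subset)
  ultimately show ?thesis using KR by auto
qed

lemma root_unique: "(THE x. x \<in> V \<and> (\<forall>u\<in>V. (x, u) \<in> R)) = r"
  using root R_antisym by (intro the_equality) auto

end

section \<open>The algorithm\<close>

definition enum :: "'q set \<Rightarrow> 'q list" where
  "enum Q = (SOME qs. set qs = Q \<and> distinct qs)"

text \<open>The continuation receives the set of positively answered queries, which for the oracle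
  of \<open>R\<close> is \<open>Q \<inter> R\<close>.\<close>

definition ask :: "'q set \<Rightarrow> ('q set \<Rightarrow> ('q, 'r) query_alg) \<Rightarrow> ('q, 'r) query_alg" where
  "ask Q k = Round (enum Q) (\<lambda>bs. k {q. (q, True) \<in> set (zip (enum Q) bs)})"

definition probes :: "'v \<times> 'v \<times> 'v \<Rightarrow> 'v set \<Rightarrow> ('v \<times> 'v) set" where
  "probes \<tau> P = (case \<tau> of (v, w, w') \<Rightarrow> P \<times> {v, w, w'})"

definition draw :: "'v set set \<Rightarrow> ('v set \<Rightarrow> 'v \<times> 'v \<times> 'v) pmf" where
  "draw \<pi> = Pi_pmf \<pi> undefined (\<lambda>P. pmf_of_set (P \<times> P \<times> P))"

text \<open>The first round of a level determines the pivots. The second compares each pivot with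
  its part in both directions: its descendants give the split, its ancestors the pairs for
  \<open>through\<close>.\<close>

primrec split_levels :: "nat \<Rightarrow> (('v \<times> 'v) set \<Rightarrow> ('v \<times> 'v, 'r) query_alg) \<Rightarrow>
    'v set set \<Rightarrow> ('v \<times> 'v) set \<Rightarrow> ('v \<times> 'v, 'r) query_alg" where
  "split_levels 0 fin \<pi> K = fin K"
| "split_levels (Suc l) fin \<pi> K = Random (map_pmf (\<lambda>\<tau>.
     ask (\<Union>P\<in>\<pi>. probes (\<tau> P) P) (\<lambda>A.
     ask (\<Union>P\<in>\<pi>. {pivot A (\<tau> P) P} \<times> P \<union> P \<times> {pivot A (\<tau> P) P}) (\<lambda>B.
       split_levels l fin (refine B (\<lambda>P. pivot A (\<tau> P) P) \<pi>)
         (K \<union> through B (\<lambda>P. pivot A (\<tau> P) P) \<pi>)))) (draw \<pi>))"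

definition decode :: "'v set \<Rightarrow> ('v \<times> 'v) set \<Rightarrow> 'v \<times> ('v \<times> 'v) set" where
  "decode V Q = (THE x. x \<in> V \<and> (\<forall>u\<in>V. (x, u) \<in> Q), {(u, v). v \<in> covers Q u})"

definition repair :: "'v set \<Rightarrow> ('v \<times> 'v) set \<Rightarrow> ('v \<times> 'v, 'v \<times> ('v \<times> 'v) set) query_alg" where
  "repair V K = ask (child_queries K) (\<lambda>A.
     let D = snd ` (A - K); x = top_of K D in
     ask (V \<times> {x}) (\<lambda>B. Output (decode V (K \<union> {(a, u). (a, x) \<in> B \<and> u \<in> D}))))"

text \<open>The number of ordered pairs of distinct vertices that share a part.\<close>

definition potential :: "'v set set \<Rightarrow> nat" where
  "potential \<pi> = (\<Sum>P\<in>\<pi>. card P * (card P - 1))"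

section \<open>Execution of queries and random choices\<close>

lemma enum: "finite Q \<Longrightarrow> set (enum Q) = Q \<and> distinct (enum Q)"
  unfolding enum_def by (rule someI_ex) (rule finite_distinct_list)

lemma run_ask:
  assumes "finite Q"
  shows "run_alg (\<lambda>q. q \<in> R) (ask Q k) =
    map_pmf (\<lambda>(x, q, \<rho>). (x, q + card Q, \<rho> + 1)) (run_alg (\<lambda>q. q \<in> R) (k (Q \<inter> R)))"
proof -
  have "{q. (q, True) \<in> set (zip (enum Q) (map (\<lambda>q. q \<in> R) (enum Q)))} = Q \<inter> R"
    using enum[OF assms] by (auto simp: zip_map2 zip_same_conv_map)
  moreover have "length (enum Q) = card Q" using enum[OF assms] distinct_card by metis
  ultimately show ?thesis by (simp add: ask_def)
qed

lemma run_random: "run_alg orc (Random (map_pmf f M)) = bind_pmf M (\<lambda>x. run_alg orc (f x))"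
  by (simp add: bind_eq_join_pmf map_pmf_comp)

lemma prob_bind_pmf_ge:
  assumes fin: "finite (set_pmf M)"
    and g: "\<And>x. x \<in> set_pmf M \<Longrightarrow> g x \<le> measure_pmf.prob (N x) A"
  shows "measure_pmf.expectation M g \<le> measure_pmf.prob (bind_pmf M N) A"
proof -
  have int: "integrable (measure_pmf M) f" for f :: "_ \<Rightarrow> real"
    by (rule integrable_measure_pmf_finite[OF fin])
  have "ennreal (measure_pmf.prob (bind_pmf M N) A) = (\<integral>\<^sup>+x. ennreal (measure_pmf.prob (N x) A) \<partial>M)"
    by (simp flip: measure_pmf.emeasure_eq_measure)
  also have "\<dots> = ennreal (measure_pmf.expectation M (\<lambda>x. measure_pmf.prob (N x) A))"
    by (rule nn_integral_eq_integral[OF int]) simp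
  finally have "measure_pmf.prob (bind_pmf M N) A
      = measure_pmf.expectation M (\<lambda>x. measure_pmf.prob (N x) A)"
    by (subst (asm) ennreal_inj) (auto intro!: integral_nonneg_AE)
  also have "\<dots> \<ge> measure_pmf.expectation M g"
    by (rule integral_mono_AE[OF int int]) (auto simp: AE_measure_pmf_iff g)
  finally show ?thesis .
qed

text \<open>The choice of the pivot inspects only probed pairs, so the answers can replace
  \<open>R\<close>.\<close>

lemma pivot_cong:
  assumes "\<And>x. x \<in> P \<Longrightarrow> probes \<tau> P \<inter> R \<subseteq> Q" "Q \<subseteq> R"
  shows "pivot Q \<tau> P = pivot R \<tau> P"
proof -
  obtain v w w' where \<tau>: "\<tau> = (v, w, w')" by (cases \<tau>)
  have "(x, z) \<in> Q \<longleftrightarrow> (x, z) \<in> R" if "x \<in> P" "z \<in> {v, w, w'}" for x z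
    using assms(1)[OF that(1)] assms(2) that unfolding probes_def \<tau> by auto
  then have "x \<in> P \<and> (x, v) \<in> Q \<and> (x, w) \<in> Q \<and> (x, w') \<notin> Q \<longleftrightarrow>
      x \<in> P \<and> (x, v) \<in> R \<and> (x, w) \<in> R \<and> (x, w') \<notin> R" for x
    by blast
  then show ?thesis unfolding \<tau> pivot.simps Bex_def by presburger
qed

lemma refine_cong:
  assumes "\<And>P u. P \<in> \<pi> \<Longrightarrow> u \<in> P \<Longrightarrow> (x P, u) \<in> Q \<longleftrightarrow> (x P, u) \<in> R"
  shows "refine Q x \<pi> = refine R x \<pi>"
proof -
  have "{u \<in> P. (x P, u) \<in> Q} = {u \<in> P. (x P, u) \<in> R}"
    "{u \<in> P. (x P, u) \<notin> Q} = {u \<in> P. (x P, u) \<notin> R}" if "P \<in> \<pi>" for P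
    using assms[OF that] by auto
  then show ?thesis unfolding refine_def by (intro arg_cong2[where f = "(-)"] SUP_cong) simp_all
qed

lemma through_cong:
  assumes "\<And>P u. P \<in> \<pi> \<Longrightarrow> u \<in> P \<Longrightarrow> (x P, u) \<in> Q \<longleftrightarrow> (x P, u) \<in> R"
    and "\<And>P u. P \<in> \<pi> \<Longrightarrow> u \<in> P \<Longrightarrow> (u, x P) \<in> Q \<longleftrightarrow> (u, x P) \<in> R"
  shows "through Q x \<pi> = through R x \<pi>"
  unfolding through_def using assms by blast

lemma refine_fun_cong:
  assumes "\<And>P. P \<in> \<pi> \<Longrightarrow> x P = y P"
  shows "refine Q x \<pi> = refine Q y \<pi>" "through Q x \<pi> = through Q y \<pi>"
  using assms by (auto simp: refine_def through_def)

section \<open>The potential under a random split\<close>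

lemma potential_refine:
  assumes "finite \<pi>" and fin: "\<And>P. P \<in> \<pi> \<Longrightarrow> finite P"
  shows "potential (refine R x \<pi>) +
    (\<Sum>P\<in>\<pi>. 2 * card {u \<in> P. (x P, u) \<in> R} * card {u \<in> P. (x P, u) \<notin> R}) \<le> potential \<pi>"
proof -
  let ?f = "\<lambda>P :: 'a set. card P * (card P - 1)"
  let ?X = "\<lambda>P. {u \<in> P. (x P, u) \<in> R}" and ?Y = "\<lambda>P. {u \<in> P. (x P, u) \<notin> R}"
  have "potential (refine R x \<pi>) \<le> sum ?f (\<Union>P\<in>\<pi>. {?X P, ?Y P})"
    unfolding potential_def refine_def using assms(1) by (intro sum_mono2) auto
  \<comment> \<open>Only an inequality, because equal pieces are counted once in the set on the
    left.\<close>
  also have "\<dots> \<le> (\<Sum>P\<in>\<pi>. ?f (?X P) + ?f (?Y P))"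
    using assms(1)
  proof (induction \<pi> rule: finite_induct)
    case (insert P \<pi>)
    have fin\<pi>: "finite (\<Union>P\<in>\<pi>. {?X P, ?Y P})" using insert.hyps(1) by simp
    have "sum ?f (\<Union>P\<in>insert P \<pi>. {?X P, ?Y P}) \<le> sum ?f {?X P, ?Y P} + sum ?f (\<Union>P\<in>\<pi>. {?X P, ?Y P})"
      unfolding UN_insert by (subst sum_Un_nat[OF _ fin\<pi>]) (rule finite.intros | rule diff_le_self)+
    also have "sum ?f {?X P, ?Y P} \<le> ?f (?X P) + ?f (?Y P)"
      by (cases "?X P = ?Y P") auto
    finally have "sum ?f (\<Union>P\<in>insert P \<pi>. {?X P, ?Y P})
      \<le> ?f (?X P) + ?f (?Y P) + sum ?f (\<Union>P\<in>\<pi>. {?X P, ?Y P})" by simp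
    also have "\<dots> \<le> (\<Sum>P\<in>insert P \<pi>. ?f (?X P) + ?f (?Y P))"
      unfolding sum.insert[OF insert.hyps] using insert.IH by (rule add_left_mono)
    finally show ?case .
  qed simp
  finally have le: "potential (refine R x \<pi>) \<le> (\<Sum>P\<in>\<pi>. ?f (?X P) + ?f (?Y P))" .
  have "?f (?X P) + ?f (?Y P) + 2 * card (?X P) * card (?Y P) = ?f P" if "P \<in> \<pi>" for P
  proof -
    have "card P = card (?X P \<union> ?Y P)" by (rule arg_cong[where f = card]) auto
    also have "\<dots> = card (?X P) + card (?Y P)"
      using fin[OF that] by (intro card_Un_disjoint) auto
    finally have "card P = card (?X P) + card (?Y P)" .
    moreover have "i * (i - 1) + j * (j - 1) + 2 * i * j = (i + j) * (i + j - 1)" for i j :: nat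
      by (cases i; cases j) (auto simp: algebra_simps)
    ultimately show ?thesis by metis
  qed
  then have "(\<Sum>P\<in>\<pi>. ?f (?X P) + ?f (?Y P)) + (\<Sum>P\<in>\<pi>. 2 * card (?X P) * card (?Y P)) = potential \<pi>"
    unfolding potential_def by (simp flip: sum.distrib)
  then show ?thesis using le by linarith
qed

lemma set_draw:
  assumes "finite \<pi>" "\<And>P. P \<in> \<pi> \<Longrightarrow> finite P \<and> P \<noteq> {}"
  shows "finite (set_pmf (draw \<pi>))" "\<tau> \<in> set_pmf (draw \<pi>) \<Longrightarrow> P \<in> \<pi> \<Longrightarrow> \<tau> P \<in> P \<times> P \<times> P"
proof -
  have set: "set_pmf (draw \<pi>) = PiE_dflt \<pi> undefined (\<lambda>P. P \<times> P \<times> P)"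
    unfolding draw_def set_Pi_pmf[OF assms(1)] using assms(2)
    by (auto simp: PiE_dflt_def)
  show "finite (set_pmf (draw \<pi>))"
    unfolding set using assms by (intro finite_PiE_dflt) auto
  show "\<tau> P \<in> P \<times> P \<times> P" if "\<tau> \<in> set_pmf (draw \<pi>)" "P \<in> \<pi>"
    using that unfolding set PiE_dflt_def by auto
qed

lemma expectation_draw:
  fixes g :: "'v \<times> 'v \<times> 'v \<Rightarrow> real"
  assumes "finite \<pi>" "P \<in> \<pi>" "finite P" "P \<noteq> {}"
  shows "measure_pmf.expectation (draw \<pi>) (\<lambda>\<tau>. g (\<tau> P)) = (\<Sum>\<tau>\<in>P \<times> P \<times> P. g \<tau>) / card P ^ 3"
proof -
  have "measure_pmf.expectation (draw \<pi>) (\<lambda>\<tau>. g (\<tau> P))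
      = measure_pmf.expectation (map_pmf (\<lambda>\<tau>. \<tau> P) (draw \<pi>)) g"
    by simp
  also have "map_pmf (\<lambda>\<tau>. \<tau> P) (draw \<pi>) = pmf_of_set (P \<times> P \<times> P)"
    unfolding draw_def by (subst Pi_pmf_component) (use assms in auto)
  finally show ?thesis
    using assms by (simp add: integral_pmf_of_set card_cartesian_product power3_eq_cube mult.assoc)
qed

section \<open>Cost and success probability\<close>

context almost_tree_order
begin

abbreviation pivots :: "('v set \<Rightarrow> 'v \<times> 'v \<times> 'v) \<Rightarrow> 'v set \<Rightarrow> 'v" where
  "pivots \<tau> P \<equiv> pivot R (\<tau> P) P"

lemma state_ok_partsD:
  assumes "state_ok \<pi> K"
  shows "partition_on V \<pi>" "finite \<pi>" "P \<in> \<pi> \<Longrightarrow> P \<subseteq> V" "P \<in> \<pi> \<Longrightarrow> finite P \<and> P \<noteq> {}"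
    "P \<in> \<pi> \<Longrightarrow> convex_part R P" "(\<Sum>P\<in>\<pi>. card P) = card V"
proof -
  show \<pi>: "partition_on V \<pi>" using assms by (simp add: state_ok_def)
  then show fin: "finite \<pi>" using finite_V finite_elements by blast
  have V: "V = \<Union>\<pi>" using partition_onD1[OF \<pi>] .
  then show "P \<in> \<pi> \<Longrightarrow> P \<subseteq> V" by blast
  then show "P \<in> \<pi> \<Longrightarrow> finite P \<and> P \<noteq> {}"
    using partition_onD3[OF \<pi>] finite_subset finite_V by metis
  show "P \<in> \<pi> \<Longrightarrow> convex_part R P" using assms by (simp add: state_ok_def)
  have "finite A" if "A \<in> \<pi>" for A
    by (rule finite_subset[OF _ finite_V]) (use that V in blast)
  then show "(\<Sum>P\<in>\<pi>. card P) = card V"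
    using card_Union_disjoint[OF partition_onD2[OF \<pi>]] V by metis
qed

text \<open>The constant is half of 24576, since the potential counts every separated pair in both
  orders.\<close>

lemma expected_potential:
  assumes ok: "state_ok \<pi> K"
  shows "measure_pmf.expectation (draw \<pi>) (\<lambda>\<tau>. real (potential (refine R (pivots \<tau>) \<pi>)))
    \<le> (1 - 1 / (12288 * real d ^ 3)) * potential \<pi>"
proof -
  note parts = state_ok_partsD[OF ok]
  let ?g = "\<lambda>P \<tau>. 2 * card {u \<in> P. (pivot R \<tau> P, u) \<in> R} * card {u \<in> P. (pivot R \<tau> P, u) \<notin> R}"
  let ?E = "measure_pmf.expectation (draw \<pi>)"
  have fin: "finite (set_pmf (draw \<pi>))" using set_draw(1) parts by blast
  have int: "integrable (measure_pmf (draw \<pi>)) f" for f :: "_ \<Rightarrow> real"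
    by (rule integrable_measure_pmf_finite[OF fin])
  have gain: "real (card P * (card P - 1)) / (12288 * real d ^ 3) \<le> ?E (\<lambda>\<tau>. real (?g P (\<tau> P)))"
    if P: "P \<in> \<pi>" for P
  proof (cases "card P \<ge> 2")
    case False
    then have zero: "card P * (card P - 1) = 0" by auto
    show ?thesis unfolding zero by (auto intro!: integral_nonneg_AE)
  next
    case True
    let ?S = "\<Sum>\<tau>\<in>P \<times> P \<times> P. card {u \<in> P. (pivot R \<tau> P, u) \<in> R} * card {u \<in> P. (pivot R \<tau> P, u) \<notin> R}"
    have le: "card P ^ 5 \<le> 24576 * d ^ 3 * ?S"
      using pivot_splits_on_average[OF parts(3,5)[OF P] True] .
    have "d \<noteq> 0"
    proof
      assume "d = 0"
      then have "card P ^ 5 = 0" using le by simp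
      then show False using True by simp
    qed
    have "real (card P * (card P - 1)) \<le> real (card P ^ 2)"
      unfolding power2_eq_square by (intro of_nat_mono mult_le_mono) simp_all
    then have "real (card P * (card P - 1)) / (12288 * real d ^ 3) \<le> real (card P ^ 2) / (12288 * real d ^ 3)"
      by (rule divide_right_mono) simp
    also have "\<dots> \<le> 2 * real ?S / real (card P) ^ 3"
    proof -
      have "real (card P) ^ 2 * real (card P) ^ 3 = real (card P ^ 5)" by (simp flip: power_add)
      also have "\<dots> \<le> real (24576 * d ^ 3 * ?S)" using le by (rule of_nat_mono)
      also have "\<dots> = 2 * real ?S * (12288 * real d ^ 3)" by (simp only: of_nat_mult) simp
      finally have "real (card P) ^ 2 * real (card P) ^ 3 \<le> 2 * real ?S * (12288 * real d ^ 3)" .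
      then show ?thesis using True \<open>d \<noteq> 0\<close> by (simp add: divide_simps)
    qed
    also have "\<dots> = ?E (\<lambda>\<tau>. real (?g P (\<tau> P)))"
      using parts P expectation_draw[of \<pi> P "\<lambda>\<tau>. real (?g P \<tau>)"]
      by (simp add: sum_distrib_left mult.assoc)
    finally show ?thesis .
  qed
  have "?E (\<lambda>\<tau>. real (potential (refine R (pivots \<tau>) \<pi>)))
      \<le> ?E (\<lambda>\<tau>. real (potential \<pi>) - (\<Sum>P\<in>\<pi>. real (?g P (\<tau> P))))"
  proof (rule integral_mono[OF int int])
    fix \<tau>
    have "potential (refine R (pivots \<tau>) \<pi>) + (\<Sum>P\<in>\<pi>. ?g P (\<tau> P)) \<le> potential \<pi>"
      by (rule potential_refine) (use parts in auto)
    then have "real (potential (refine R (pivots \<tau>) \<pi>) + (\<Sum>P\<in>\<pi>. ?g P (\<tau> P))) \<le> real (potential \<pi>)"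
      by (rule of_nat_mono)
    then show "real (potential (refine R (pivots \<tau>) \<pi>)) \<le> real (potential \<pi>) - (\<Sum>P\<in>\<pi>. real (?g P (\<tau> P)))"
      by simp
  qed
  also have "\<dots> = potential \<pi> - (\<Sum>P\<in>\<pi>. ?E (\<lambda>\<tau>. real (?g P (\<tau> P))))"
    by (subst Bochner_Integration.integral_diff[OF int int], subst Bochner_Integration.integral_sum)
      (auto intro: int)
  also have "\<dots> \<le> potential \<pi> - (\<Sum>P\<in>\<pi>. real (card P * (card P - 1)) / (12288 * real d ^ 3))"
    using gain by (intro diff_left_mono sum_mono)
  also have "\<dots> = (1 - 1 / (12288 * real d ^ 3)) * potential \<pi>"
    by (simp add: potential_def sum_divide_distrib left_diff_distrib)
  finally show ?thesis .
qed

lemma singletons_if_potential_0: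
  assumes ok: "state_ok \<pi> K" and "potential \<pi> = 0" and P: "P \<in> \<pi>" "a \<in> P" "u \<in> P"
  shows "a = u"
proof -
  have "card P * (card P - 1) = 0"
    using assms(2) P state_ok_partsD(2)[OF ok] by (simp add: potential_def)
  then have "card P \<le> 1" using state_ok_partsD(4)[OF ok P(1)] by auto
  then show ?thesis using card_le_Suc0_iff_eq[of P] state_ok_partsD(4)[OF ok P(1)] P by auto
qed

abbreviation orc :: "'v \<times> 'v \<Rightarrow> bool" where
  "orc \<equiv> \<lambda>q. q \<in> R"

lemma run_repair:
  assumes KR: "K \<subseteq> R" and KV: "Id_on V \<subseteq> K" and gap: "R - K = {} \<or> (\<exists>D. branch_gap (R - K) D)"
  shows "\<exists>q \<le> card V * (H * d) + card V. run_alg orc (repair V K) = return_pmf (decode V R, q, 2)"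
proof -
  define D where "D = snd ` (child_queries K \<inter> R - K)"
  have rep: "K \<union> {(a, u). (a, top_of K D) \<in> (V \<times> {top_of K D}) \<inter> R \<and> u \<in> D} = R"
    by (rule gap_repaired[OF assms D_def])
  have "run_alg orc (repair V K) =
      return_pmf (decode V R, card (V \<times> {top_of K D}) + card (child_queries K), 2)"
    unfolding repair_def run_ask[OF child_queries_bound(1)[OF assms]] Let_def D_def[symmetric]
      run_ask[OF finite_cartesian_product[OF finite_V finite.insertI[OF finite.emptyI]]]
      run_alg.simps rep
    by simp
  then show ?thesis
    using child_queries_bound(2)[OF assms] by (auto simp: card_cartesian_product)
qed

lemma card_level_queries:
  assumes ok: "state_ok \<pi> K"
  shows "finite (\<Union>P\<in>\<pi>. probes (\<tau> P) P)" "card (\<Union>P\<in>\<pi>. probes (\<tau> P) P) \<le> 3 * card V"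
    "finite (\<Union>P\<in>\<pi>. {x P} \<times> P \<union> P \<times> {x P})"
    "card (\<Union>P\<in>\<pi>. {x P} \<times> P \<union> P \<times> {x P}) \<le> 2 * card V"
proof -
  note parts = state_ok_partsD[OF ok]
  have pr: "finite (probes (\<tau> P) P)" "card (probes (\<tau> P) P) \<le> 3 * card P" if "P \<in> \<pi>" for P
  proof -
    obtain v w w' where \<tau>: "\<tau> P = (v, w, w')" by (cases "\<tau> P")
    have "card {v, w, w'} \<le> 3" by (simp add: card_insert_if)
    then show "finite (probes (\<tau> P) P)" "card (probes (\<tau> P) P) \<le> 3 * card P"
      using parts(4)[OF that] by (auto simp: probes_def \<tau> card_cartesian_product)
  qed
  then show "finite (\<Union>P\<in>\<pi>. probes (\<tau> P) P)" using parts(2) by blast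
  have "card (\<Union>P\<in>\<pi>. probes (\<tau> P) P) \<le> (\<Sum>P\<in>\<pi>. card (probes (\<tau> P) P))"
    by (rule card_UN_le[OF parts(2)])
  also have "\<dots> \<le> (\<Sum>P\<in>\<pi>. 3 * card P)" using pr by (intro sum_mono)
  finally show "card (\<Union>P\<in>\<pi>. probes (\<tau> P) P) \<le> 3 * card V"
    by (simp add: parts(6) flip: sum_distrib_left)
  show "finite (\<Union>P\<in>\<pi>. {x P} \<times> P \<union> P \<times> {x P})" using parts(2,4) by blast
  have "card (\<Union>P\<in>\<pi>. {x P} \<times> P \<union> P \<times> {x P}) \<le> (\<Sum>P\<in>\<pi>. card ({x P} \<times> P \<union> P \<times> {x P}))"
    by (rule card_UN_le[OF parts(2)])
  also have "\<dots> \<le> (\<Sum>P\<in>\<pi>. 2 * card P)"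
  proof (rule sum_mono)
    fix P
    show "card ({x P} \<times> P \<union> P \<times> {x P}) \<le> 2 * card P"
      using card_Un_le[of "{x P} \<times> P" "P \<times> {x P}"] by (simp add: card_cartesian_product)
  qed
  finally show "card (\<Union>P\<in>\<pi>. {x P} \<times> P \<union> P \<times> {x P}) \<le> 2 * card V"
    by (simp add: parts(6) flip: sum_distrib_left)
qed

lemma run_split_levels_Suc:
  assumes ok: "state_ok \<pi> K"
  shows "run_alg orc (split_levels (Suc l) fin \<pi> K) = bind_pmf (draw \<pi>) (\<lambda>\<tau>.
    map_pmf (\<lambda>(x, q, \<rho>). (x, q + card (\<Union>P\<in>\<pi>. {pivots \<tau> P} \<times> P \<union> P \<times> {pivots \<tau> P}) +
        card (\<Union>P\<in>\<pi>. probes (\<tau> P) P), \<rho> + 2))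
      (run_alg orc (split_levels l fin (refine R (pivots \<tau>) \<pi>) (K \<union> through R (pivots \<tau>) \<pi>))))"
proof -
  note fin = card_level_queries(1,3)[OF ok]
  have run: "run_alg orc (ask (\<Union>P\<in>\<pi>. probes (\<tau> P) P) (\<lambda>A.
     ask (\<Union>P\<in>\<pi>. {pivot A (\<tau> P) P} \<times> P \<union> P \<times> {pivot A (\<tau> P) P}) (\<lambda>B.
       split_levels l fin (refine B (\<lambda>P. pivot A (\<tau> P) P) \<pi>)
         (K \<union> through B (\<lambda>P. pivot A (\<tau> P) P) \<pi>)))) =
    map_pmf (\<lambda>(x, q, \<rho>). (x, q + card (\<Union>P\<in>\<pi>. {pivots \<tau> P} \<times> P \<union> P \<times> {pivots \<tau> P}) +
        card (\<Union>P\<in>\<pi>. probes (\<tau> P) P), \<rho> + 2))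
      (run_alg orc (split_levels l fin (refine R (pivots \<tau>) \<pi>) (K \<union> through R (pivots \<tau>) \<pi>)))"
    for \<tau>
  proof -
    define A where "A = (\<Union>P\<in>\<pi>. probes (\<tau> P) P) \<inter> R"
    define Q where "Q = (\<Union>P\<in>\<pi>. {pivots \<tau> P} \<times> P \<union> P \<times> {pivots \<tau> P})"
    have piv: "pivot A (\<tau> P) P = pivots \<tau> P" if "P \<in> \<pi>" for P
      by (rule pivot_cong) (use that in \<open>auto simp: A_def\<close>)
    then have QA: "(\<Union>P\<in>\<pi>. {pivot A (\<tau> P) P} \<times> P \<union> P \<times> {pivot A (\<tau> P) P}) = Q"
      unfolding Q_def by simp
    have ref: "refine B (\<lambda>P. pivot A (\<tau> P) P) \<pi> = refine B (pivots \<tau>) \<pi>"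
      "through B (\<lambda>P. pivot A (\<tau> P) P) \<pi> = through B (pivots \<tau>) \<pi>" for B
      using refine_fun_cong[of \<pi> "\<lambda>P. pivot A (\<tau> P) P" "pivots \<tau>" B] piv by blast+
    have QR: "refine (Q \<inter> R) (pivots \<tau>) \<pi> = refine R (pivots \<tau>) \<pi>"
      "through (Q \<inter> R) (pivots \<tau>) \<pi> = through R (pivots \<tau>) \<pi>"
    proof -
      show "refine (Q \<inter> R) (pivots \<tau>) \<pi> = refine R (pivots \<tau>) \<pi>"
        by (rule refine_cong) (auto simp: Q_def)
      show "through (Q \<inter> R) (pivots \<tau>) \<pi> = through R (pivots \<tau>) \<pi>"
        by (rule through_cong) (auto simp: Q_def)
    qed
    show ?thesis
      unfolding run_ask[OF fin(1)] A_def[symmetric] QA ref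
      using fin(2)[of "pivots \<tau>"] unfolding Q_def[symmetric]
      by (simp add: run_ask QR map_pmf_comp split_def)
  qed
  show ?thesis unfolding split_levels.simps run_random run ..
qed

text \<open>Induction on the number of levels: the failure bound is linear in the potential, so it
  passes through the expectation and gains one factor per level. Each level costs at most
  \<open>3 * card V\<close> probes and \<open>2 * card V\<close> comparisons with pivots in two
  rounds; the repair takes two more rounds.\<close>

lemma split_levels_success:
  assumes ok: "state_ok \<pi> K"
  shows "1 - (1 - 1 / (12288 * real d ^ 3)) ^ l * potential \<pi> \<le>
    measure_pmf.prob (run_alg orc (split_levels l (\<lambda>K. repair V (K \<union> Id_on V)) \<pi> K))
      {(x, q, \<rho>). x = decode V R \<and> q \<le> 5 * card V * l + (card V * (H * d) + card V) \<and>
        \<rho> \<le> 2 * l + 2}"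
  using ok
proof (induction l arbitrary: \<pi> K)
  case 0
  show ?case
  proof (cases "potential \<pi> = 0")
    case True
    note single = singletons_if_potential_0[OF 0 True]
    have KR: "K \<union> Id_on V \<subseteq> R" by (rule state_ok_final(1)[OF 0], rule single)
    have gap: "R - (K \<union> Id_on V) = {} \<or> (\<exists>D. branch_gap (R - (K \<union> Id_on V)) D)"
      by (rule state_ok_final(2)[OF 0], rule single)
    obtain q where "q \<le> card V * (H * d) + card V"
      "run_alg orc (repair V (K \<union> Id_on V)) = return_pmf (decode V R, q, 2)"
      using run_repair[OF KR _ gap] by blast
    then show ?thesis by (simp add: measure_return_pmf)
  next
    \<comment> \<open>This is Markov's inequality: a nonzero potential is at least 1, so the claimed
      probability is not positive.\<close>
    case False
    then have "1 - real (potential \<pi>) \<le> 0" by simp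
    then show ?thesis by (simp add: order_trans[OF _ measure_nonneg])
  qed
next
  case (Suc l)
  let ?e = "1 - 1 / (12288 * real d ^ 3)"
  let ?fin = "\<lambda>K. repair V (K \<union> Id_on V)"
  let ?G = "\<lambda>l. {(x, q, \<rho>). x = decode V R \<and> q \<le> 5 * card V * l + (card V * (H * d) + card V) \<and>
        \<rho> \<le> 2 * l + 2}"
  note parts = state_ok_partsD[OF Suc.prems]
  have e: "0 \<le> ?e"
  \<comment> \<open>For \<open>d = 0\<close> the quotient is 0 by the convention for division by
    zero.\<close>
  proof (cases "d = 0")
    case False
    then have "1 \<le> real d ^ 3" by simp
    then show ?thesis by (simp add: divide_simps)
  qed simp
  have fin: "finite (set_pmf (draw \<pi>))" using set_draw(1) parts by blast
  have int: "integrable (measure_pmf (draw \<pi>)) f" for f :: "_ \<Rightarrow> real"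
    by (rule integrable_measure_pmf_finite[OF fin])
  have "1 - ?e ^ Suc l * potential \<pi>
      \<le> 1 - ?e ^ l * measure_pmf.expectation (draw \<pi>) (\<lambda>\<tau>. real (potential (refine R (pivots \<tau>) \<pi>)))"
    using mult_left_mono[OF expected_potential[OF Suc.prems], of "?e ^ l"] e
    by (simp add: mult.assoc mult.left_commute)
  also have "\<dots> = measure_pmf.expectation (draw \<pi>)
      (\<lambda>\<tau>. 1 - ?e ^ l * real (potential (refine R (pivots \<tau>) \<pi>)))"
    by (subst Bochner_Integration.integral_diff[OF int int]) simp
  also have "\<dots> \<le> measure_pmf.prob (run_alg orc (split_levels (Suc l) ?fin \<pi> K)) (?G (Suc l))"
    unfolding run_split_levels_Suc[OF Suc.prems]
  proof (rule prob_bind_pmf_ge[OF fin])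
    fix \<tau> assume \<tau>: "\<tau> \<in> set_pmf (draw \<pi>)"
    have "state_ok (refine R (pivots \<tau>) \<pi>) (K \<union> through R (pivots \<tau>) \<pi>)"
      by (rule state_ok_step[OF Suc.prems], rule pivot_in, rule set_draw(2)[OF _ _ \<tau>])
        (use parts in auto)
    note Suc.IH[OF this]
    also have "measure_pmf.prob M (?G l) \<le>
        measure_pmf.prob (map_pmf (\<lambda>(x, q, \<rho>). (x, q + card (\<Union>P\<in>\<pi>. {pivots \<tau> P} \<times> P \<union> P \<times> {pivots \<tau> P}) +
          card (\<Union>P\<in>\<pi>. probes (\<tau> P) P), \<rho> + 2)) M) (?G (Suc l))" for M
      using card_level_queries(2)[OF Suc.prems, of \<tau>] card_level_queries(4)[OF Suc.prems, of "pivots \<tau>"]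
      by (auto intro!: measure_pmf.finite_measure_mono)
    finally show "1 - ?e ^ l * real (potential (refine R (pivots \<tau>) \<pi>)) \<le>
      measure_pmf.prob (map_pmf (\<lambda>(x, q, \<rho>). (x, q + card (\<Union>P\<in>\<pi>. {pivots \<tau> P} \<times> P \<union> P \<times> {pivots \<tau> P}) +
          card (\<Union>P\<in>\<pi>. probes (\<tau> P) P), \<rho> + 2)) (run_alg orc (split_levels l ?fin
            (refine R (pivots \<tau>) \<pi>) (K \<union> through R (pivots \<tau>) \<pi>)))) (?G (Suc l))" .
  qed
  finally show ?case .
qed

end

theorem theorem8:
  fixes d :: nat
  shows "\<exists>(A :: 'v set \<Rightarrow> ('v \<times> 'v, 'v \<times> ('v \<times> 'v) set) query_alg)
            (c :: real) (C\<^sub>1 :: real) (C\<^sub>2 :: real).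
    c \<ge> 1 \<and>
    (\<forall>(G :: 'v pair_pre_digraph) r n h.
      almost_tree G r \<longrightarrow> card (pverts G) = n \<longrightarrow> dag_height G = h \<longrightarrow>
      (\<forall>v\<in>pverts G. vertex_degree G v \<le> d) \<longrightarrow> (\<forall>e. \<not> transitive_edge G e) \<longrightarrow>
      measure_pmf.prob (run_alg (path_query G) (A (pverts G)))
        {((root, edges), q, \<rho>). root = r \<and> edges = parcs G \<and>
           real q \<le> C\<^sub>1 * (real n * log 2 (real n) + real n * real h) \<and>
           real \<rho> \<le> C\<^sub>2 * log 2 (real n)}
      \<ge> 1 - 1 / real n powr c)"
proof -
  \<comment> \<open>A positive degree bound, so that \<open>E\<close> is at least 1.\<close>
  define D where "D = Suc d"
  define E where "E = 12288 * real D ^ 3"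
  define B where "B = 3 * E + 1"
  \<comment> \<open>After this many levels the factor is at most \<open>1 / n ^ 3\<close>, which
    beats the initial potential, below \<open>n ^ 2\<close>, by \<open>1 / n\<close>.\<close>
  define L where "L n = nat \<lceil>3 * E * ln (real n)\<rceil>" for n
  define A :: "'v set \<Rightarrow> ('v \<times> 'v, 'v \<times> ('v \<times> 'v) set) query_alg"
    where "A V = split_levels (L (card V)) (\<lambda>K. repair V (K \<union> Id_on V)) {V} {}" for V
  have "1 \<le> real D ^ 3" by (rule one_le_power) (simp add: D_def)
  then have E: "E \<ge> 1" by (simp add: E_def)
  have "1 - 1 / real n powr 1 \<le> measure_pmf.prob (run_alg (path_query G) (A (pverts G)))
        {((root, edges), q, \<rho>). root = r \<and> edges = parcs G \<and>
           real q \<le> (5 * B + 3 * D + 1) * (real n * log 2 (real n) + real n * real h) \<and>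
           real \<rho> \<le> (2 * B + 2) * log 2 (real n)}"
    if G: "almost_tree G r" and n: "card (pverts G) = n" and h: "dag_height G = h"
      and deg: "\<forall>v\<in>pverts G. vertex_degree G v \<le> d" and notrans: "\<forall>e. \<not> transitive_edge G e"
    for G :: "'v pair_pre_digraph" and r n h
  proof -
    define R where "R = {(u, v). path_query G (u, v)}"
    have deg': "vertex_degree G v \<le> D" if "v \<in> pverts G" for v
      using deg that by (auto simp: D_def intro: le_SucI)
    have notrans': "\<not> transitive_edge G e" for e using notrans by blast
    obtain t s p where "almost_tree_order (pverts G) R r t s p D (3 * (h + 1))"
      using almost_tree_imp_order[OF G notrans' deg' R_def] unfolding h .
    then interpret almost_tree_order "pverts G" R r t s p D "3 * (h + 1)" .
    have "rooted_dag G r" using G by (simp add: almost_tree_def)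
    note parcs = parcs_eq_covers[OF this notrans' R_def]
    have orc: "path_query G = orc" by (auto simp: R_def fun_eq_iff)
    \<comment> \<open>An almost-tree has at least two vertices, so \<open>log 2 n\<close> is at
      least 1 and absorbs additive constants.\<close>
    have "{s, t} \<subseteq> pverts G" "s \<noteq> t" using R_in_V t_above t_refl by auto
    then have "2 \<le> n" unfolding n[symmetric] using card_mono[OF finite_V, of "{s, t}"] by simp
    then have n2: "2 \<le> real n" by simp
    have log1: "1 \<le> log 2 (real n)" using n2 by simp
    have ln_log: "0 \<le> ln (real n)" "ln (real n) \<le> log 2 (real n)"
      using n2 ln_2_less_1 by (auto simp: log_def divide_simps mult_left_le)
    have L_ge: "3 * E * ln (real n) \<le> real (L n)" unfolding L_def by linarith
    have "real (L n) \<le> 3 * E * ln (real n) + 1"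
      unfolding L_def using E ln_log by simp
    also have "\<dots> \<le> 3 * E * log 2 (real n) + log 2 (real n)"
      using E ln_log log1 by (intro add_mono mult_left_mono) auto
    finally have L_le: "real (L n) \<le> B * log 2 (real n)" by (simp add: B_def algebra_simps)
    have "(1 - 1 / E) ^ L n \<le> exp (- (1 / E)) ^ L n"
      using E exp_ge_add_one_self[of "- (1 / E)"] by (intro power_mono) auto
    also have "\<dots> = exp (- (real (L n) / E))" by (simp flip: exp_of_nat_mult)
    also have "\<dots> \<le> exp (- (3 * ln (real n)))"
      using L_ge E by (simp add: field_simps)
    also have "\<dots> = 1 / real n ^ 3"
      using n2 exp_of_nat_mult[of 3 "ln (real n)"] by (simp add: exp_minus inverse_eq_divide)
    finally have fail: "(1 - 1 / E) ^ L n \<le> 1 / real n ^ 3" .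
    have "potential {pverts G} = n * (n - 1)" by (simp add: potential_def n)
    also have "\<dots> \<le> n ^ 2" unfolding power2_eq_square by (intro mult_le_mono) simp_all
    finally have "real (potential {pverts G}) \<le> real n ^ 2" by (metis of_nat_mono of_nat_power)
    then have "(1 - 1 / E) ^ L n * potential {pverts G} \<le> 1 / real n ^ 3 * real n ^ 2"
      using fail by (intro mult_mono) auto
    also have "\<dots> = 1 / real n" using n2 by (simp add: power2_eq_square power3_eq_cube)
    finally have "1 - 1 / real n powr 1 \<le> 1 - (1 - 1 / E) ^ L n * potential {pverts G}"
      using n2 by simp
    also have "\<dots> \<le> measure_pmf.prob (run_alg (path_query G) (A (pverts G)))
      {(x, q, \<rho>). x = decode (pverts G) R \<and>
        q \<le> 5 * card (pverts G) * L n + (card (pverts G) * (3 * (h + 1) * D) + card (pverts G)) \<and>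
        \<rho> \<le> 2 * L n + 2}"
      using split_levels_success[OF state_ok_init, of "L n"] unfolding A_def orc n E_def by simp
    also have "\<dots> \<le> measure_pmf.prob (run_alg (path_query G) (A (pverts G)))
        {((root, edges), q, \<rho>). root = r \<and> edges = parcs G \<and>
           real q \<le> (5 * B + 3 * D + 1) * (real n * log 2 (real n) + real n * real h) \<and>
           real \<rho> \<le> (2 * B + 2) * log 2 (real n)}"
    proof (rule measure_pmf.finite_measure_mono, clarify)
      fix root edges q \<rho>
      assume res: "(root, edges) = decode (pverts G) R"
        and q: "q \<le> 5 * card (pverts G) * L n + (card (pverts G) * (3 * (h + 1) * D) + card (pverts G))"
        and \<rho>: "\<rho> \<le> 2 * L n + 2"
      have "root = r \<and> edges = parcs G"
        using res root_unique parcs by (simp add: decode_def)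
      moreover have "real q \<le> (5 * B + 3 * D + 1) * (real n * log 2 (real n) + real n * real h)"
      proof -
        have "real q \<le> real (5 * n * L n + (n * (3 * (h + 1) * D) + n))"
          using q unfolding n by (rule of_nat_mono)
        \<comment> \<open>The three summands account for the levels, the child queries and the final
          query for the ancestors of \<open>t\<close>; the factors 1 are written out to be replaced
          by the logarithm.\<close>
        also have "\<dots> = 5 * (real n * real (L n)) + 3 * D * (real n * 1 + real n * h) + real n * 1"
          by (simp add: algebra_simps)
        also have "\<dots> \<le> 5 * (real n * (B * log 2 (real n))) +
            3 * D * (real n * log 2 (real n) + real n * h) + real n * log 2 (real n)"
          using L_le log1 by (intro add_mono mult_left_mono) auto
        also have "\<dots> \<le> 5 * B * (real n * log 2 (real n) + real n * h) +
            3 * D * (real n * log 2 (real n) + real n * h) + (real n * log 2 (real n) + real n * h)"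
          using E by (intro add_mono) (auto simp: B_def algebra_simps)
        finally show ?thesis by (simp add: algebra_simps)
      qed
      moreover have "real \<rho> \<le> (2 * B + 2) * log 2 (real n)"
      proof -
        have "real \<rho> \<le> 2 * real (L n) + 2 * 1" using of_nat_mono[OF \<rho>, where 'a = real] by simp
        also have "\<dots> \<le> 2 * (B * log 2 (real n)) + 2 * log 2 (real n)"
          using L_le log1 by (intro add_mono mult_left_mono) auto
        finally show ?thesis by (simp add: algebra_simps)
      qed
      ultimately show "root = r \<and> edges = parcs G \<and>
           real q \<le> (5 * B + 3 * D + 1) * (real n * log 2 (real n) + real n * real h) \<and>
           real \<rho> \<le> (2 * B + 2) * log 2 (real n)" by blast
    qed simp
    finally show ?thesis .
  qed
  then show ?thesis by (intro exI[of _ A] exI[of _ 1] exI[of _ "5 * B + 3 * D + 1"] exI[of _ "2 * B + 2"]) auto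
qed

end
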